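(* Fix $\delta>0$. Then \[\lim_{p\to0}\frac{\phi(p,\delta)}{p^2\log(1/p)}=\min\Big\{\frac{\delta^{2/3}}{2},\frac{\delta}{3}\Big\}.\]
   Context: For $0<p<1$ and $x\in[0,1]$ let $I_p(x)=x\log\frac{x}{p}+(1-x)\log\frac{1-x}{1-p}$ (with $0\log0=0$). A graphon is a symmetric measurable $W:[0,1]^2\to[0,1]$; $t(W)=\int_{[0,1]^3}W(x,y)W(x,z)W(y,z)\,dx\,dy\,dz$, $\mathbb{E}[I_p(W)]=\int_{[0,1]^2}I_p(W(x,y))\,dx\,dy$, and $\phi(p,\delta)=\inf\{\tfrac12\mathbb{E}[I_p(W)]: W\text{ graphon},\ t(W)\ge(1+\delta)p^3\}$. *)

theory Defs
  imports "HOL-Analysis.Analysis"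
begin

(* The convention 0 log 0 = 0 is automatic: the factor x (resp. 1 - x) is 0. *)
definition I_ent :: "real \<Rightarrow> real \<Rightarrow> real" where
  "I_ent p x = x * ln (x / p) + (1 - x) * ln ((1 - x) / (1 - p))"

(* Only the restriction of W to the unit square matters. Measurability is Lebesgue
   measurability; W is not required to be Borel. *)
definition graphon :: "(real \<Rightarrow> real \<Rightarrow> real) \<Rightarrow> bool" where
  "graphon W \<longleftrightarrow>
     (\<lambda>(x, y). W x y) \<in> borel_measurable (lebesgue_on ({0..1} \<times> {0..1})) \<and>
     (\<forall>x\<in>{0..1}. \<forall>y\<in>{0..1}. W x y = W y x) \<and>
     (\<forall>x\<in>{0..1}. \<forall>y\<in>{0..1}. W x y \<in> {0..1})"

(* For a graphon the integrands below are bounded and Lebesgue measurable, so the Bochner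
   integrals are genuine and not the default value 0. *)
definition tri_density :: "(real \<Rightarrow> real \<Rightarrow> real) \<Rightarrow> real" where
  "tri_density W =
     (LINT (x, y, z)|lebesgue_on ({0..1} \<times> {0..1} \<times> {0..1}). W x y * W x z * W y z)"

definition graphon_entropy :: "real \<Rightarrow> (real \<Rightarrow> real \<Rightarrow> real) \<Rightarrow> real" where
  "graphon_entropy p W = (LINT (x, y)|lebesgue_on ({0..1} \<times> {0..1}). I_ent p (W x y))"

(* The infimum is over a set of reals bounded below by 0. It is nonempty (W = 1 is admissible)
   exactly when (1 + \<delta>) * p ^ 3 \<le> 1, in particular for all small p > 0; for other p the
   value is unspecified, which does not affect the limit p -> 0. *)
definition phi :: "real \<Rightarrow> real \<Rightarrow> real" where
  "phi p \<delta> =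
     Inf {graphon_entropy p W / 2 | W. graphon W \<and> tri_density W \<ge> (1 + \<delta>) * p ^ 3}"

end

theory Submission
  imports Defs "HOL-Probability.Probability_Measure" "HOL-Real_Asymp.Real_Asymp"
begin

text \<open>
  Write \<open>U = max (W - p) 0\<close>. Then \<open>I_p(W) \<ge> J_p(U)\<close> pointwise, where \<open>J_p(u) \<ge> (1 - o(1)) u^2 log(1/p)\<close> on
  \<open>[0,1]\<close>, and \<open>t(W) \<le> p^3 + 3 p^2 \<integral>U + 3 p \<integral>d^2 + t(U)\<close> with \<open>d(x) = \<integral>U(x,y) dy\<close>. If the entropy is of
  order \<open>p^2 log(1/p)\<close>, then the term with \<open>\<integral>U\<close> is negligible, and so is the contribution to
  \<open>\<integral>d^2\<close> of the points of degree at most \<open>b = p^(1/12)\<close>. The set \<open>B = {d > b}\<close> is so small that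
  triangles meeting it can be ignored in \<open>t(U)\<close> and the square \<open>B \<times> B\<close> can be ignored in \<open>\<integral>U^2\<close>. By
  Cauchy-Schwarz the excess \<open>\<delta>\<close> is thus at most \<open>r^(3/2) + 3\<theta>\<close> up to \<open>o(1)\<close>, while the normalised half
  entropy is at least \<open>r/2 + \<theta>\<close>; here \<open>r p^2\<close> is the mass of \<open>U^2\<close> off \<open>B\<close> and \<open>\<theta> p^2\<close> that of \<open>d^2\<close> on
  \<open>B\<close>. This is a concave minimisation in \<open>r^(3/2)\<close>, so one of the extreme points, a clique (\<open>\<theta> = 0\<close>) or a
  hub (\<open>r = 0\<close>), is optimal. Both are realised by step graphons.
\<close>

section \<open>Entropy estimates\<close>

text \<open>
  The Poisson analogue of \<open>I_p(p + u)\<close>; unlike \<open>I_p\<close> it scales, being \<open>p h(u/p)\<close> for a fixed function \<open>h\<close>.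
\<close>
definition J_ent :: "real \<Rightarrow> real \<Rightarrow> real" where
  "J_ent p x = (p + x) * ln (1 + x / p) - x"

text \<open>The inequality \<open>ln u \<le> u - 1\<close> at \<open>u = z / y\<close>, multiplied
  by \<open>y\<close>; at \<open>y = 0\<close> it only says \<open>0 \<ge> - z\<close>.
  Nonnegativity of \<open>I_ent\<close>, its comparison with \<open>J_ent\<close> and the tangent
  lines of \<open>J_ent\<close> all come from it.\<close>

lemma mult_ln_divide_ge:
  fixes y z :: real
  assumes "y \<ge> 0" "z > 0"
  shows "y * ln (y / z) \<ge> y - z"
proof (cases "y = 0")
  case False
  with assms have y: "y > 0" by simp
  have "ln (z / y) \<le> z / y - 1"
    using y assms by (intro ln_le_minus_one) simp
  moreover have "ln (y / z) = - ln (z / y)"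
    using y assms by (simp add: ln_div)
  ultimately have "1 - z / y \<le> ln (y / z)" by simp
  then have "y * (1 - z / y) \<le> y * ln (y / z)"
    using y by (intro mult_left_mono) auto
  then show ?thesis using y by (simp add: algebra_simps)
qed (use assms in simp)

lemma I_ent_nonneg:
  assumes "0 < p" "p < 1" "0 \<le> x" "x \<le> 1"
  shows "I_ent p x \<ge> 0"
  using mult_ln_divide_ge[of x p] mult_ln_divide_ge[of "1 - x" "1 - p"] assms
  by (simp add: I_ent_def)

lemma I_ent_self: "0 < p \<Longrightarrow> p < 1 \<Longrightarrow> I_ent p p = 0"
  by (simp add: I_ent_def)

lemma I_ent_one: "I_ent p 1 = ln (1 / p)"
  by (simp add: I_ent_def)

lemma J_ent_0 [simp]: "J_ent p 0 = 0"
  by (simp add: J_ent_def)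

text \<open>For \<open>w = p + u\<close> with \<open>u > 0\<close> the first summand of
  \<open>I_ent p w\<close> is exactly \<open>(p + u) * ln (1 + u / p)\<close>, and the second is at
  least \<open>- u\<close>. For \<open>w \<le> p\<close> the left side is 0.\<close>

lemma J_ent_le_I_ent:
  assumes "0 < p" "p < 1" "0 \<le> w" "w \<le> 1"
  shows "J_ent p (max (w - p) 0) \<le> I_ent p w"
proof (cases "w \<le> p")
  case True
  then show ?thesis using I_ent_nonneg[OF assms] by (simp add: max_def)
next
  case False
  have "1 + (w - p) / p = w / p" using assms by (simp add: field_simps)
  then show ?thesis
    using mult_ln_divide_ge[of "1 - w" "1 - p"] assms False
    by (simp add: I_ent_def J_ent_def max_def)
qed

text \<open>Equality holds for \<open>t = ln (1 + x / p)\<close>, which makes this the tool for Jensen's inequality below.\<close>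
lemma J_ent_ge_legendre:
  assumes "0 < p" "0 \<le> x"
  shows "(p + x) * t - p * (exp t - 1) \<le> J_ent p x"
proof -
  have "ln ((p + x) / (p * exp t)) = ln ((p + x) / p) - t"
    using assms by (simp add: ln_div ln_mult)
  also have "(p + x) / p = 1 + x / p" using assms by (simp add: field_simps)
  finally have "(p + x) * (ln (1 + x / p) - t) \<ge> p + x - p * exp t"
    using mult_ln_divide_ge[of "p + x" "p * exp t"] assms by simp
  then show ?thesis by (simp add: J_ent_def algebra_simps)
qed

text \<open>The tangent bound with slope \<open>t\<close>, simplified by
  \<open>exp t \<le> 1 + t + t^2\<close>. It later controls the integral of the excess
  \<open>U\<close> by the entropy.\<close>

lemma J_ent_ge_linear:
  assumes "0 < p" "0 \<le> x" "0 < t" "t \<le> 1"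
  shows "t * x - p * t\<^sup>2 \<le> J_ent p x"
proof -
  have "exp t \<le> 1 + t + t\<^sup>2" using assms by (intro exp_bound) auto
  then have "p * exp t \<le> p * (1 + t + t\<^sup>2)" using assms by (intro mult_left_mono) auto
  then show ?thesis using J_ent_ge_legendre[of p x t] assms by (simp add: algebra_simps)
qed

lemma J_ent_nonneg: "0 < p \<Longrightarrow> 0 \<le> x \<Longrightarrow> 0 \<le> J_ent p x"
  using J_ent_ge_legendre[of p x 0] by simp

text \<open>The difference \<open>ln (1 + u) - 2 * u / (2 + u)\<close> vanishes at 0 and has
  derivative \<open>u^2 / ((1 + u) * (2 + u)^2)\<close>. In this form it gives the sign of the
  derivative of \<open>J_ent p y / y^2\<close>.\<close>

lemma ln_one_plus_ge:
  fixes u :: real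
  assumes "u \<ge> 0"
  shows "2 * u \<le> (2 + u) * ln (1 + u)"
proof -
  have "(\<lambda>u. ln (1 + u) - 2 * u / (2 + u)) 0 \<le> (\<lambda>u. ln (1 + u) - 2 * u / (2 + u)) u"
  proof (rule DERIV_nonneg_imp_nondecreasing[OF assms])
    fix x :: real
    assume x: "0 \<le> x" "x \<le> u"
    have "((\<lambda>u. ln (1 + u) - 2 * u / (2 + u)) has_real_derivative
        1 / (1 + x) - 4 / (2 + x)\<^sup>2) (at x)"
      using x by (auto intro!: derivative_eq_intros simp: field_simps power2_eq_square)
    moreover have "1 / (1 + x) - 4 / (2 + x)\<^sup>2 = x\<^sup>2 / ((1 + x) * (2 + x)\<^sup>2)"
      using x by (simp add: divide_simps) (simp add: algebra_simps power2_eq_square)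
    then have "1 / (1 + x) - 4 / (2 + x)\<^sup>2 \<ge> 0"
      using x by simp
    ultimately show "\<exists>y. ((\<lambda>u. ln (1 + u) - 2 * u / (2 + u)) has_real_derivative y) (at x) \<and> 0 \<le> y"
      by blast
  qed
  then have "2 * u / (2 + u) \<le> ln (1 + u)" by simp
  then show ?thesis using assms by (simp add: divide_simps mult.commute)
qed

text \<open>The ratio \<open>J_ent p x / x^2\<close> is nonincreasing in \<open>x > 0\<close>, so on
  \<open>(0, b]\<close> it is smallest at \<open>b\<close>. It is used with \<open>b = 1\<close> for
  the values of the kernel and with a small \<open>b\<close> for degrees.\<close>

lemma J_ent_quadratic:
  assumes p: "0 < p" and x: "0 \<le> x" "x \<le> b"
  shows "J_ent p b * x\<^sup>2 \<le> b\<^sup>2 * J_ent p x"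
proof (cases "x = 0")
  case False
  with x have x0: "0 < x" by simp
  have "J_ent p b / b\<^sup>2 \<le> J_ent p x / x\<^sup>2"
  proof (rule DERIV_nonpos_imp_nonincreasing[OF x(2)])
    fix y assume y: "x \<le> y" "y \<le> b"
    have y0: "0 < y" using y x0 by simp
    have pos: "1 + y / p > 0" using p y0 by (simp add: add_pos_pos)
    have "(J_ent p has_real_derivative ln (1 + y / p)) (at y)"
      unfolding J_ent_def using p y0 pos
      by (auto intro!: derivative_eq_intros simp: divide_simps)
    then have "((\<lambda>y. J_ent p y / y\<^sup>2) has_real_derivative
        (ln (1 + y / p) * y\<^sup>2 - J_ent p y * (2 * y)) / (y\<^sup>2 * y\<^sup>2)) (at y)"
      using y0 by (auto intro!: derivative_eq_intros)
    moreover have "ln (1 + y / p) * y\<^sup>2 - J_ent p y * (2 * y) \<le> 0"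
    proof -
      have "2 * (y / p) \<le> (2 + y / p) * ln (1 + y / p)"
        using p y0 by (intro ln_one_plus_ge) simp
      then have "p * y * (2 * (y / p)) \<le> p * y * ((2 + y / p) * ln (1 + y / p))"
        using p y0 by (intro mult_left_mono) auto
      then have "2 * y\<^sup>2 \<le> (2 * p * y + y\<^sup>2) * ln (1 + y / p)"
        using p by (simp add: distrib_left distrib_right power2_eq_square mult.assoc mult.left_commute)
      then show ?thesis by (simp add: J_ent_def algebra_simps power2_eq_square)
    qed
    ultimately show "\<exists>z. ((\<lambda>y. J_ent p y / y\<^sup>2) has_real_derivative z) (at y) \<and> z \<le> 0"
      using y0 by (intro exI conjI) (auto intro!: divide_nonpos_pos)
  qed
  then show ?thesis using x0 x by (simp add: divide_simps mult.commute)
qed simp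

lemma J_ent_pos:
  assumes "0 < p" "0 < x"
  shows "0 < J_ent p x"
proof -
  \<comment> \<open>The maximiser \<open>x / (2 * p)\<close> of \<open>t * x - p * t^2\<close>,
    capped at 1 because the linear bound needs \<open>t \<le> 1\<close>.\<close>
  define t where "t = min 1 (x / (2 * p))"
  have t: "0 < t" "t \<le> 1" using assms by (auto simp: t_def)
  have "t \<le> x / (2 * p)" by (simp add: t_def)
  then have "2 * p * t \<le> x" using assms by (simp add: field_simps)
  moreover have "0 < p * t" using assms t by simp
  ultimately have "p * t < x" by linarith
  then have "t * (p * t) < t * x" using t by simp
  moreover have "t * (p * t) = p * t\<^sup>2" by (simp add: power2_eq_square)
  ultimately show ?thesis using J_ent_ge_linear[of p x t] assms t by linarith
qed

lemma J_ent_bound: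
  assumes "0 < p" "0 \<le> u" "u \<le> 1"
  shows "\<bar>J_ent p u\<bar> \<le> (p + 1) * ln (1 + 1 / p)"
proof -
  have "ln (1 + u / p) \<le> ln (1 + 1 / p)"
    using assms by (intro ln_mono) (auto intro!: divide_right_mono add_pos_nonneg)
  then have "(p + u) * ln (1 + u / p) \<le> (p + 1) * ln (1 + 1 / p)"
    using assms by (intro mult_mono) auto
  moreover have "0 \<le> J_ent p u" using assms by (intro J_ent_nonneg)
  ultimately show ?thesis using assms by (simp add: J_ent_def)
qed

text \<open>With \<open>v = sqrt r\<close> and \<open>c = d powr (1/3)\<close> the constraint reads
  \<open>c^3 \<le> v^3 + 3 * \<theta>\<close>. If \<open>v \<ge> c\<close>, the term
  \<open>r / 2\<close> suffices alone. Otherwise put \<open>w = v / c\<close> and bound the minimum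
  by the average of its two entries with weights \<open>w^3\<close> and \<open>1 - w^3\<close>:
  since \<open>w^3 \<le> w^2\<close>, the first part is at most \<open>r / 2\<close>, and by the
  constraint the second is at most \<open>\<theta>\<close>.\<close>

lemma min_variational:
  fixes r \<theta> :: real
  assumes "0 \<le> r" "0 \<le> \<theta>" "0 < d" "d \<le> r * sqrt r + 3 * \<theta>"
  shows "min (d powr (2/3) / 2) (d / 3) \<le> r / 2 + \<theta>"
proof -
  define v where "v = sqrt r"
  define c where "c = d powr (1/3)"
  have v: "0 \<le> v" "r = v\<^sup>2" using assms by (auto simp: v_def)
  have c: "0 < c" using assms by (simp add: c_def)
  have c3: "c ^ 3 = d" using assms by (simp add: c_def powr_power)
  have c2: "d powr (2/3) = c\<^sup>2" using assms by (simp add: c_def powr_power)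
  have le: "c ^ 3 \<le> v ^ 3 + 3 * \<theta>"
    unfolding c3 using assms(4) v(1) unfolding v(2) by (simp add: power2_eq_square power3_eq_cube)
  show ?thesis
  proof (cases "c \<le> v")
    case True
    then have "c\<^sup>2 \<le> v\<^sup>2" using c by (intro power_mono) auto
    then show ?thesis using assms(2) v c2 by simp
  next
    case False
    define w where "w = v / c"
    have w: "0 \<le> w" "w \<le> 1" "v = w * c" using v c False by (auto simp: w_def)
    have w3: "w ^ 3 \<le> w\<^sup>2" using w by (intro power_decreasing) auto
    have w31: "w ^ 3 \<le> 1" "0 \<le> w ^ 3" using w by (auto simp: power_le_one)
    let ?m = "min (c\<^sup>2 / 2) (c ^ 3 / 3)"
    have "?m = w ^ 3 * ?m + (1 - w ^ 3) * ?m" by (simp add: algebra_simps)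
    also have "\<dots> \<le> w ^ 3 * (c\<^sup>2 / 2) + (1 - w ^ 3) * (c ^ 3 / 3)"
      using w31 by (intro add_mono mult_left_mono) auto
    also have "w ^ 3 * (c\<^sup>2 / 2) \<le> w\<^sup>2 * (c\<^sup>2 / 2)"
      using w3 by (intro mult_right_mono) auto
    also have "w\<^sup>2 * (c\<^sup>2 / 2) = r / 2" using v w by (simp add: power_mult_distrib)
    also have "(1 - w ^ 3) * (c ^ 3 / 3) \<le> \<theta>"
      using le w by (simp add: algebra_simps power_mult_distrib)
    finally show ?thesis using c2 c3 by simp
  qed
qed

section \<open>Iterated integrals of bounded kernels\<close>

lemma Cauchy_Schwarz_integral:
  fixes f g :: "'a \<Rightarrow> real"
  assumes [simp]: "integrable M (\<lambda>x. (f x)\<^sup>2)" "integrable M (\<lambda>x. (g x)\<^sup>2)" "integrable M (\<lambda>x. f x * g x)"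
  shows "(\<integral>x. f x * g x \<partial>M)\<^sup>2 \<le> (\<integral>x. (f x)\<^sup>2 \<partial>M) * (\<integral>x. (g x)\<^sup>2 \<partial>M)"
proof -
  define F G H where "F = (\<integral>x. (f x)\<^sup>2 \<partial>M)" "G = (\<integral>x. f x * g x \<partial>M)" "H = (\<integral>x. (g x)\<^sup>2 \<partial>M)"
  have quad: "0 \<le> a\<^sup>2 * F - 2 * a * G + H" for a
  proof -
    have "0 \<le> (\<integral>x. (a * f x - g x)\<^sup>2 \<partial>M)" by simp
    also have "(\<lambda>x. (a * f x - g x)\<^sup>2) = (\<lambda>x. a\<^sup>2 * (f x)\<^sup>2 - 2 * a * (f x * g x) + (g x)\<^sup>2)"
      by (auto simp: power2_eq_square algebra_simps)
    finally show ?thesis by (simp add: F_G_H_def)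
  qed
  have "0 \<le> F" by (simp add: F_G_H_def)
  show ?thesis
  proof (cases "F = 0")
    case True
    have "G = 0"
    proof (rule ccontr)
      assume "G \<noteq> 0"
      \<comment> \<open>For \<open>F = 0\<close> the quadratic degenerates to
        \<open>H - 2 * a * G\<close>, which equals -1 at this \<open>a\<close>.\<close>
      with quad[of "(H + 1) / (2 * G)"] True show False by (simp add: field_simps)
    qed
    with True show ?thesis by (simp add: F_G_H_def)
  next
    case False
    with \<open>0 \<le> F\<close> have "0 < F" by simp
    then have "G\<^sup>2 \<le> F * H"
      \<comment> \<open>The minimiser of the quadratic.\<close>
      using quad[of "G / F"] by (simp add: field_simps power2_eq_square)
    then show ?thesis by (simp add: F_G_H_def)
  qed
qed

lemma (in prob_space) integrable_bounded:
  fixes f :: "'a \<Rightarrow> real"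
  assumes "f \<in> borel_measurable M" "\<And>x. \<bar>f x\<bar> \<le> K"
  shows "integrable M f"
  using assms by (intro integrable_const_bound[where B = K]) auto

section \<open>Bounded kernels in two and three variables: integrability, Fubini and
  linearity\<close>

context prob_space
begin

abbreviation double_integral :: "('a \<Rightarrow> 'a \<Rightarrow> real) \<Rightarrow> real" where
  "double_integral f \<equiv> (\<integral>x. \<integral>y. f x y \<partial>M \<partial>M)"

abbreviation triple_integral :: "('a \<Rightarrow> 'a \<Rightarrow> 'a \<Rightarrow> real) \<Rightarrow> real" where
  "triple_integral f \<equiv> (\<integral>x. \<integral>y. \<integral>z. f x y z \<partial>M \<partial>M \<partial>M)"

text \<open>On a probability space this guarantees integrability, so Fubini always applies. The
  bound holds on the whole type and not only on the space, which keeps membership conditions out of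
  pointwise estimates.\<close>

definition bounded2 :: "('a \<Rightarrow> 'a \<Rightarrow> real) \<Rightarrow> bool" where
  "bounded2 f \<longleftrightarrow> (\<lambda>(x, y). f x y) \<in> borel_measurable (M \<Otimes>\<^sub>M M) \<and> (\<exists>K. \<forall>x y. \<bar>f x y\<bar> \<le> K)"

definition bounded3 :: "('a \<Rightarrow> 'a \<Rightarrow> 'a \<Rightarrow> real) \<Rightarrow> bool" where
  "bounded3 f \<longleftrightarrow> (\<lambda>(x, y, z). f x y z) \<in> borel_measurable (M \<Otimes>\<^sub>M (M \<Otimes>\<^sub>M M)) \<and>
     (\<exists>K. \<forall>x y z. \<bar>f x y z\<bar> \<le> K)"

lemma integrable2:
  assumes "bounded2 f"
  shows "integrable (M \<Otimes>\<^sub>M M) (\<lambda>(x, y). f x y)"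
proof -
  interpret P: pair_prob_space M M ..
  from assms obtain K where "\<And>x y. \<bar>f x y\<bar> \<le> K" by (auto simp: bounded2_def)
  then show ?thesis using assms
    by (intro P.integrable_bounded[where K = K]) (auto simp: bounded2_def)
qed

lemma double_integral_eq:
  assumes "bounded2 f"
  shows "double_integral f = (\<integral>(x, y). f x y \<partial>(M \<Otimes>\<^sub>M M))"
proof -
  interpret P: pair_prob_space M M ..
  show ?thesis using P.integral_fst'[OF integrable2[OF assms]] by simp
qed

lemma double_integral_swap:
  assumes "bounded2 f"
  shows "double_integral (\<lambda>x y. f y x) = double_integral f"
proof -
  interpret P: pair_prob_space M M ..
  show ?thesis using P.Fubini_integral[of "\<lambda>x y. f x y"] integrable2[OF assms] by simp
qed

lemma integrable3:
  assumes "bounded3 f"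
  shows "integrable (M \<Otimes>\<^sub>M (M \<Otimes>\<^sub>M M)) (\<lambda>(x, y, z). f x y z)"
proof -
  interpret P: pair_prob_space M M ..
  interpret Q: pair_prob_space M "M \<Otimes>\<^sub>M M" ..
  from assms obtain K where "\<And>x y z. \<bar>f x y z\<bar> \<le> K" by (auto simp: bounded3_def)
  then show ?thesis using assms
    by (intro Q.integrable_bounded[where K = K]) (auto simp: bounded3_def)
qed

lemma bounded2_slice:
  assumes "bounded3 f" "x \<in> space M"
  shows "bounded2 (f x)"
proof -
  have [measurable]: "(\<lambda>(x, y, z). f x y z) \<in> borel_measurable (M \<Otimes>\<^sub>M (M \<Otimes>\<^sub>M M))"
    using assms by (simp add: bounded3_def)
  have "(\<lambda>(y, z). (\<lambda>(x, y, z). f x y z) (x, y, z)) \<in> borel_measurable (M \<Otimes>\<^sub>M M)"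
    using assms(2) by measurable
  then show ?thesis using assms by (auto simp: bounded2_def bounded3_def)
qed

lemma integrable1_slice:
  assumes "bounded2 f" "x \<in> space M"
  shows "integrable M (f x)"
proof -
  have [measurable]: "(\<lambda>(x, y). f x y) \<in> borel_measurable (M \<Otimes>\<^sub>M M)"
    using assms by (simp add: bounded2_def)
  have "(\<lambda>y. (\<lambda>(x, y). f x y) (x, y)) \<in> borel_measurable M"
    using assms(2) by measurable
  then have "f x \<in> borel_measurable M" by simp
  moreover obtain K where "\<And>x y. \<bar>f x y\<bar> \<le> K" using assms by (auto simp: bounded2_def)
  ultimately show ?thesis by (rule integrable_bounded)
qed

lemma integral_abs_bound:
  fixes f :: "'a \<Rightarrow> real"
  assumes "\<And>x. \<bar>f x\<bar> \<le> K"
  shows "\<bar>\<integral>x. f x \<partial>M\<bar> \<le> K"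
proof (cases "integrable M f")
  case True
  have "\<bar>\<integral>x. f x \<partial>M\<bar> \<le> (\<integral>x. \<bar>f x\<bar> \<partial>M)" by (rule integral_abs_bound)
  also have "\<dots> \<le> (\<integral>x. K \<partial>M)" using True assms by (intro integral_mono) auto
  finally show ?thesis by (simp add: prob_space)
next
  case False
  \<comment> \<open>A function that is not integrable has integral 0 by default, and
    \<open>K\<close> is nonnegative because it bounds an absolute value.\<close>
  then show ?thesis using assms[of undefined] by (simp add: not_integrable_integral_eq)
qed

lemma bounded2_marginal:
  assumes "bounded3 f"
  shows "bounded2 (\<lambda>x y. \<integral>z. f x y z \<partial>M)"
proof -
  have [measurable]: "(\<lambda>(x, y, z). f x y z) \<in> borel_measurable (M \<Otimes>\<^sub>M (M \<Otimes>\<^sub>M M))"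
    using assms by (simp add: bounded3_def)
  have "(\<lambda>w. \<integral>z. (\<lambda>(x, y, z). f x y z) (fst w, snd w, z) \<partial>M) \<in> borel_measurable (M \<Otimes>\<^sub>M M)"
    by measurable
  moreover obtain K where "\<And>x y z. \<bar>f x y z\<bar> \<le> K" using assms by (auto simp: bounded3_def)
  then have "\<bar>\<integral>z. f x y z \<partial>M\<bar> \<le> K" for x y by (intro integral_abs_bound)
  ultimately show ?thesis by (auto simp: bounded2_def split_beta)
qed

lemma integrable_marginal:
  assumes "bounded2 f"
  shows "integrable M (\<lambda>x. \<integral>y. f x y \<partial>M)"
proof -
  interpret P: pair_prob_space M M ..
  show ?thesis using P.integrable_fst'[OF integrable2[OF assms]] by simp
qed

lemma triple_integral_eq:
  assumes "bounded3 f"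
  shows "triple_integral f = (\<integral>(x, y, z). f x y z \<partial>(M \<Otimes>\<^sub>M (M \<Otimes>\<^sub>M M)))"
proof -
  interpret P: pair_prob_space M M ..
  interpret Q: pair_prob_space M "M \<Otimes>\<^sub>M M" ..
  have "(\<integral>(x, y, z). f x y z \<partial>(M \<Otimes>\<^sub>M (M \<Otimes>\<^sub>M M))) = (\<integral>x. \<integral>(y, z). f x y z \<partial>(M \<Otimes>\<^sub>M M) \<partial>M)"
    using Q.integral_fst'[OF integrable3[OF assms]] by simp
  also have "\<dots> = triple_integral f"
    by (intro Bochner_Integration.integral_cong refl)
       (simp add: double_integral_eq[OF bounded2_slice[OF assms]])
  finally show ?thesis by simp
qed

lemma triple_integral_mono:
  assumes "bounded3 f" "bounded3 g" "\<And>x y z. f x y z \<le> g x y z"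
  shows "triple_integral f \<le> triple_integral g"
  unfolding triple_integral_eq[OF assms(1)] triple_integral_eq[OF assms(2)]
  using assms by (intro integral_mono integrable3) auto

lemma bounded3_add: "bounded3 f \<Longrightarrow> bounded3 g \<Longrightarrow> bounded3 (\<lambda>x y z. f x y z + g x y z)"
proof -
  assume *: "bounded3 f" "bounded3 g"
  then have [measurable]: "(\<lambda>(x, y, z). f x y z) \<in> borel_measurable (M \<Otimes>\<^sub>M (M \<Otimes>\<^sub>M M))"
    "(\<lambda>(x, y, z). g x y z) \<in> borel_measurable (M \<Otimes>\<^sub>M (M \<Otimes>\<^sub>M M))" by (auto simp: bounded3_def)
  from * obtain K L where "\<And>x y z. \<bar>f x y z\<bar> \<le> K" "\<And>x y z. \<bar>g x y z\<bar> \<le> L"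
    by (auto simp: bounded3_def)
  then have "\<bar>f x y z + g x y z\<bar> \<le> K + L" for x y z
    using abs_triangle_ineq[of "f x y z" "g x y z"] by (meson add_mono order_trans)
  moreover have "(\<lambda>w. (\<lambda>(x, y, z). f x y z) w + (\<lambda>(x, y, z). g x y z) w) \<in> borel_measurable (M \<Otimes>\<^sub>M (M \<Otimes>\<^sub>M M))"
    by measurable
  ultimately show ?thesis by (auto simp: bounded3_def split_beta)
qed

lemma bounded3_mult: "bounded3 f \<Longrightarrow> bounded3 g \<Longrightarrow> bounded3 (\<lambda>x y z. f x y z * g x y z)"
proof -
  assume *: "bounded3 f" "bounded3 g"
  then have [measurable]: "(\<lambda>(x, y, z). f x y z) \<in> borel_measurable (M \<Otimes>\<^sub>M (M \<Otimes>\<^sub>M M))"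
    "(\<lambda>(x, y, z). g x y z) \<in> borel_measurable (M \<Otimes>\<^sub>M (M \<Otimes>\<^sub>M M))" by (auto simp: bounded3_def)
  from * obtain K L where "\<And>x y z. \<bar>f x y z\<bar> \<le> K" "\<And>x y z. \<bar>g x y z\<bar> \<le> L"
    by (auto simp: bounded3_def)
  then have "\<bar>f x y z * g x y z\<bar> \<le> K * L" for x y z
    unfolding abs_mult by (intro mult_mono) (auto intro: order_trans[OF abs_ge_zero])
  moreover have "(\<lambda>w. (\<lambda>(x, y, z). f x y z) w * (\<lambda>(x, y, z). g x y z) w) \<in> borel_measurable (M \<Otimes>\<^sub>M (M \<Otimes>\<^sub>M M))"
    by measurable
  ultimately show ?thesis by (auto simp: bounded3_def split_beta)
qed

lemma bounded3_const: "bounded3 (\<lambda>x y z. c)"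
  by (auto simp: bounded3_def)

text \<open>The three edges of a triangle as functions of the triple of its vertices.\<close>

lemma bounded3_12: "bounded2 f \<Longrightarrow> bounded3 (\<lambda>x y z. f x y)"
  and bounded3_13: "bounded2 f \<Longrightarrow> bounded3 (\<lambda>x y z. f x z)"
  and bounded3_23: "bounded2 f \<Longrightarrow> bounded3 (\<lambda>x y z. f y z)"
proof -
  assume *: "bounded2 f"
  then have [measurable]: "(\<lambda>(x, y). f x y) \<in> borel_measurable (M \<Otimes>\<^sub>M M)" by (auto simp: bounded2_def)
  have "(\<lambda>w. (\<lambda>(x, y). f x y) (fst w, fst (snd w))) \<in> borel_measurable (M \<Otimes>\<^sub>M (M \<Otimes>\<^sub>M M))"
    "(\<lambda>w. (\<lambda>(x, y). f x y) (fst w, snd (snd w))) \<in> borel_measurable (M \<Otimes>\<^sub>M (M \<Otimes>\<^sub>M M))"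
    "(\<lambda>w. (\<lambda>(x, y). f x y) (fst (snd w), snd (snd w))) \<in> borel_measurable (M \<Otimes>\<^sub>M (M \<Otimes>\<^sub>M M))"
    by measurable
  with * show "bounded3 (\<lambda>x y z. f x y)" "bounded3 (\<lambda>x y z. f x z)" "bounded3 (\<lambda>x y z. f y z)"
    by (auto simp: bounded3_def bounded2_def split_beta)
qed

lemma triple_integral_add:
  assumes "bounded3 f" "bounded3 g"
  shows "triple_integral (\<lambda>x y z. f x y z + g x y z) = triple_integral f + triple_integral g"
proof -
  have "(\<integral>w. (\<lambda>(x, y, z). f x y z) w + (\<lambda>(x, y, z). g x y z) w \<partial>(M \<Otimes>\<^sub>M (M \<Otimes>\<^sub>M M))) =
    (\<integral>(x, y, z). f x y z \<partial>(M \<Otimes>\<^sub>M (M \<Otimes>\<^sub>M M))) + (\<integral>(x, y, z). g x y z \<partial>(M \<Otimes>\<^sub>M (M \<Otimes>\<^sub>M M)))"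
    by (intro Bochner_Integration.integral_add integrable3 assms)
  moreover have "(\<lambda>w. (\<lambda>(x, y, z). f x y z) w + (\<lambda>(x, y, z). g x y z) w) =
      (\<lambda>(x, y, z). f x y z + g x y z)"
    by auto
  ultimately show ?thesis
    by (simp only: triple_integral_eq assms bounded3_add)
qed

lemma triple_integral_swap12:
  assumes "bounded3 f"
  shows "triple_integral (\<lambda>x y z. f y x z) = triple_integral f"
  using double_integral_swap[OF bounded2_marginal[OF assms]] .

lemma triple_integral_swap23:
  assumes "bounded3 f"
  shows "triple_integral (\<lambda>x y z. f x z y) = triple_integral f"
  by (intro Bochner_Integration.integral_cong refl double_integral_swap bounded2_slice[OF assms])

lemma bounded2_add: "bounded2 f \<Longrightarrow> bounded2 g \<Longrightarrow> bounded2 (\<lambda>x y. f x y + g x y)"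
proof -
  assume *: "bounded2 f" "bounded2 g"
  then have [measurable]: "(\<lambda>(x, y). f x y) \<in> borel_measurable (M \<Otimes>\<^sub>M M)"
    "(\<lambda>(x, y). g x y) \<in> borel_measurable (M \<Otimes>\<^sub>M M)" by (auto simp: bounded2_def)
  from * obtain K L where "\<And>x y. \<bar>f x y\<bar> \<le> K" "\<And>x y. \<bar>g x y\<bar> \<le> L"
    by (auto simp: bounded2_def)
  then have "\<bar>f x y + g x y\<bar> \<le> K + L" for x y
    using abs_triangle_ineq[of "f x y" "g x y"] by (meson add_mono order_trans)
  moreover have "(\<lambda>w. (\<lambda>(x, y). f x y) w + (\<lambda>(x, y). g x y) w) \<in> borel_measurable (M \<Otimes>\<^sub>M M)"
    by measurable
  ultimately show ?thesis by (auto simp: bounded2_def split_beta)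
qed

lemma bounded2_mult: "bounded2 f \<Longrightarrow> bounded2 g \<Longrightarrow> bounded2 (\<lambda>x y. f x y * g x y)"
proof -
  assume *: "bounded2 f" "bounded2 g"
  then have [measurable]: "(\<lambda>(x, y). f x y) \<in> borel_measurable (M \<Otimes>\<^sub>M M)"
    "(\<lambda>(x, y). g x y) \<in> borel_measurable (M \<Otimes>\<^sub>M M)" by (auto simp: bounded2_def)
  from * obtain K L where "\<And>x y. \<bar>f x y\<bar> \<le> K" "\<And>x y. \<bar>g x y\<bar> \<le> L"
    by (auto simp: bounded2_def)
  then have "\<bar>f x y * g x y\<bar> \<le> K * L" for x y
    unfolding abs_mult by (intro mult_mono) (auto intro: order_trans[OF abs_ge_zero])
  moreover have "(\<lambda>w. (\<lambda>(x, y). f x y) w * (\<lambda>(x, y). g x y) w) \<in> borel_measurable (M \<Otimes>\<^sub>M M)"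
    by measurable
  ultimately show ?thesis by (auto simp: bounded2_def split_beta)
qed

lemma bounded2_const: "bounded2 (\<lambda>x y. c)"
  by (auto simp: bounded2_def)

lemma bounded2_fst: "g \<in> borel_measurable M \<Longrightarrow> (\<And>x. \<bar>g x\<bar> \<le> K) \<Longrightarrow> bounded2 (\<lambda>x y. g x)"
  and bounded2_snd: "g \<in> borel_measurable M \<Longrightarrow> (\<And>x. \<bar>g x\<bar> \<le> K) \<Longrightarrow> bounded2 (\<lambda>x y. g y)"
  unfolding bounded2_def split_beta by (auto intro!: exI[of _ K])

lemma double_integral_add:
  assumes "bounded2 f" "bounded2 g"
  shows "double_integral (\<lambda>x y. f x y + g x y) = double_integral f + double_integral g"
proof -
  have "(\<integral>w. (\<lambda>(x, y). f x y) w + (\<lambda>(x, y). g x y) w \<partial>(M \<Otimes>\<^sub>M M)) =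
    (\<integral>(x, y). f x y \<partial>(M \<Otimes>\<^sub>M M)) + (\<integral>(x, y). g x y \<partial>(M \<Otimes>\<^sub>M M))"
    by (intro Bochner_Integration.integral_add integrable2 assms)
  moreover have "(\<lambda>w. (\<lambda>(x, y). f x y) w + (\<lambda>(x, y). g x y) w) = (\<lambda>(x, y). f x y + g x y)"
    by auto
  ultimately show ?thesis
    by (simp only: double_integral_eq assms bounded2_add)
qed

lemma double_integral_mono:
  assumes "bounded2 f" "bounded2 g" "\<And>x y. f x y \<le> g x y"
  shows "double_integral f \<le> double_integral g"
  unfolding double_integral_eq[OF assms(1)] double_integral_eq[OF assms(2)]
  using assms by (intro integral_mono integrable2) auto

end

section \<open>Decomposition of the excess\<close>

context prob_space
begin

text \<open>For fixed \<open>x\<close>, Cauchy-Schwarz in \<open>(y, z)\<close> separates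
  \<open>V x y * V x z\<close> from \<open>V y z\<close>. The square of the first factor has
  integral \<open>(v x)^2\<close>, so the inner integral is at most \<open>v x * sqrt R\<close>, and
  \<open>v\<close> integrates to \<open>R\<close>. This is the clique term of the excess.\<close>

lemma triangle_integral_le:
  assumes V: "bounded2 V"
  defines "R \<equiv> double_integral (\<lambda>x y. (V x y)\<^sup>2)"
  shows "triple_integral (\<lambda>x y z. V x y * V x z * V y z) \<le> R * sqrt R"
proof -
  define v where "v = (\<lambda>x. \<integral>y. (V x y)\<^sup>2 \<partial>M)"
  have V2: "bounded2 (\<lambda>x y. (V x y)\<^sup>2)"
    unfolding power2_eq_square by (intro bounded2_mult V)
  have v0: "0 \<le> v x" for x by (simp add: v_def)
  have b3: "bounded3 (\<lambda>x y z. V x y * V x z * V y z)"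
    by (intro bounded3_mult bounded3_12 bounded3_13 bounded3_23 V)
  have inner: "double_integral (\<lambda>y z. V x y * V x z * V y z) \<le> v x * sqrt R" if x: "x \<in> space M" for x
  proof -
    have s: "bounded2 (\<lambda>y z. V x y * V x z)"
      using bounded2_slice[OF bounded3_mult[OF bounded3_12[OF V] bounded3_13[OF V]] x] .
    have s2: "bounded2 (\<lambda>y z. (V x y * V x z)\<^sup>2)"
      using bounded2_mult[OF s s] by (simp add: power2_eq_square)
    have "(\<integral>w. (\<lambda>(y, z). V x y * V x z) w * (\<lambda>(y, z). V y z) w \<partial>(M \<Otimes>\<^sub>M M))\<^sup>2 \<le>
        (\<integral>w. ((\<lambda>(y, z). V x y * V x z) w)\<^sup>2 \<partial>(M \<Otimes>\<^sub>M M)) * (\<integral>w. ((\<lambda>(y, z). V y z) w)\<^sup>2 \<partial>(M \<Otimes>\<^sub>M M))"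
      using integrable2[OF s2] integrable2[OF V2] integrable2[OF bounded2_mult[OF s V]]
      by (intro Cauchy_Schwarz_integral) (simp_all add: case_prod_unfold)
    then have "(double_integral (\<lambda>y z. V x y * V x z * V y z))\<^sup>2 \<le>
        double_integral (\<lambda>y z. (V x y * V x z)\<^sup>2) * R"
      unfolding R_def double_integral_eq[OF s2] double_integral_eq[OF V2]
        double_integral_eq[OF bounded2_mult[OF s V]] by (simp add: case_prod_unfold)
    also have "double_integral (\<lambda>y z. (V x y * V x z)\<^sup>2) = (v x)\<^sup>2"
      by (simp add: power_mult_distrib v_def) (simp add: power2_eq_square)
    finally have "\<bar>double_integral (\<lambda>y z. V x y * V x z * V y z)\<bar> \<le> sqrt ((v x)\<^sup>2 * R)"
      using real_sqrt_le_mono by fastforce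
    then show ?thesis using v0[of x] by (simp add: real_sqrt_mult)
  qed
  have "triple_integral (\<lambda>x y z. V x y * V x z * V y z) \<le> (\<integral>x. v x * sqrt R \<partial>M)"
    using integrable_marginal[OF bounded2_marginal[OF b3]] integrable_marginal[OF V2]
    by (intro integral_mono inner) (auto simp: v_def)
  also have "\<dots> = R * sqrt R" by (simp add: v_def R_def)
  finally show ?thesis .
qed

lemma square_integral_le:
  fixes f :: "'a \<Rightarrow> real"
  assumes "integrable M f" "integrable M (\<lambda>x. (f x)\<^sup>2)"
  shows "(\<integral>x. f x \<partial>M)\<^sup>2 \<le> (\<integral>x. (f x)\<^sup>2 \<partial>M)"
  using Cauchy_Schwarz_integral[of M f "\<lambda>_. 1"] assms by (simp add: prob_space)

text \<open>Of the eight terms of the product, the three single edges each integrate to the integral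
  of \<open>U\<close>, and the three paths of length two each integrate to the integral of the
  squared degree.\<close>

lemma triangle_expansion:
  assumes U: "bounded2 U" and sym: "\<And>x y. U x y = U y x"
  shows "triple_integral (\<lambda>x y z. (p + U x y) * (p + U x z) * (p + U y z)) =
    p ^ 3 + 3 * p\<^sup>2 * double_integral U + 3 * p * (\<integral>x. (\<integral>y. U x y \<partial>M)\<^sup>2 \<partial>M) +
    triple_integral (\<lambda>x y z. U x y * U x z * U y z)"
proof -
  define d where "d = (\<lambda>x. \<integral>y. U x y \<partial>M)"
  note bs = bounded3_add bounded3_mult bounded3_const bounded3_12[OF U] bounded3_13[OF U] bounded3_23[OF U]
  have d_sym: "(\<integral>x. U x y \<partial>M) = d y" for y
    unfolding d_def by (subst sym) simp
  have 1: "triple_integral (\<lambda>x y z. U x y * U x z) = (\<integral>x. (d x)\<^sup>2 \<partial>M)"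
    by (simp add: d_def power2_eq_square)
  \<comment> \<open>Exchanging variables moves the centre of the path to \<open>x\<close>; symmetry
    of \<open>U\<close> then restores the order of arguments.\<close>
  have 2: "triple_integral (\<lambda>x y z. U x y * U y z) = (\<integral>x. (d x)\<^sup>2 \<partial>M)"
  proof -
    have "triple_integral (\<lambda>x y z. U x y * U y z) = triple_integral (\<lambda>x y z. U y x * U x z)"
      by (rule triple_integral_swap12[symmetric]) (intro bs)
    then show ?thesis using 1 by (simp add: sym)
  qed
  have 3: "triple_integral (\<lambda>x y z. U x z * U y z) = (\<integral>x. (d x)\<^sup>2 \<partial>M)"
  proof -
    have "triple_integral (\<lambda>x y z. U x z * U y z) = triple_integral (\<lambda>x y z. U x y * U z y)"
      by (rule triple_integral_swap23[symmetric]) (intro bs)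
    then show ?thesis using 2 sym by simp
  qed
  have "triple_integral (\<lambda>x y z. (p + U x y) * (p + U x z) * (p + U y z)) =
    triple_integral (\<lambda>x y z. p ^ 3 + (p\<^sup>2 * U x y + (p\<^sup>2 * U x z + (p\<^sup>2 * U y z +
      (p * (U x y * U x z) + (p * (U x y * U y z) + (p * (U x z * U y z) + U x y * U x z * U y z)))))))"
    by (simp add: algebra_simps power2_eq_square power3_eq_cube)
  also have "\<dots> = p ^ 3 + 3 * p\<^sup>2 * double_integral U + 3 * p * (\<integral>x. (d x)\<^sup>2 \<partial>M) +
    triple_integral (\<lambda>x y z. U x y * U x z * U y z)"
    apply (subst triple_integral_add, (intro bs)+)+
    using 1 2 3 by (simp add: prob_space algebra_simps)
  finally show ?thesis by (simp add: d_def)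
qed

lemma bounded2_J_ent:
  assumes "bounded2 U" "\<And>x y. 0 \<le> U x y" "\<And>x y. U x y \<le> 1" "0 < p"
  shows "bounded2 (\<lambda>x y. J_ent p (U x y))"
proof -
  have [measurable]: "(\<lambda>(x, y). U x y) \<in> borel_measurable (M \<Otimes>\<^sub>M M)"
    using assms by (simp add: bounded2_def)
  have [measurable]: "J_ent p \<in> borel_measurable borel"
    unfolding J_ent_def[abs_def] by measurable
  have "(\<lambda>w. J_ent p ((\<lambda>(x, y). U x y) w)) \<in> borel_measurable (M \<Otimes>\<^sub>M M)"
    by measurable
  then show ?thesis
    unfolding bounded2_def using J_ent_bound[OF assms(4) assms(2,3)] by (auto simp: split_beta)
qed

text \<open>Integrate the supporting line of \<open>J_ent p\<close> at the mean \<open>m\<close>;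
  its slope is \<open>s = ln (1 + m / p)\<close>, for which the tangent bound is an equality at
  \<open>m\<close>.\<close>

lemma J_ent_jensen:
  assumes f: "integrable M f" and Jf: "integrable M (\<lambda>x. J_ent p (f x))"
    and nonneg: "\<And>x. 0 \<le> f x" and p: "0 < p"
  shows "J_ent p (\<integral>x. f x \<partial>M) \<le> (\<integral>x. J_ent p (f x) \<partial>M)"
proof -
  define m s where "m = (\<integral>x. f x \<partial>M)" and "s = ln (1 + m / p)"
  have "0 \<le> m" using nonneg by (simp add: m_def)
  then have "exp s = 1 + m / p" using p by (simp add: s_def add_pos_nonneg)
  then have "J_ent p m = p * s + m * s - p * (exp s - 1)"
    using p by (simp add: J_ent_def s_def algebra_simps)
  also have "\<dots> = (\<integral>x. (p * s - p * (exp s - 1)) + f x * s \<partial>M)"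
    using f by (simp add: m_def prob_space)
  also have "\<dots> \<le> (\<integral>x. J_ent p (f x) \<partial>M)"
    using f Jf J_ent_ge_legendre[OF p nonneg, of _ s]
    by (intro integral_mono) (auto simp: algebra_simps)
  finally show ?thesis by (simp add: m_def)
qed

text \<open>
  The witnesses are \<open>S = \<integral>U\<close>, \<open>Q = \<integral>U^2\<close>, the measure \<open>\<Lambda>\<close> of \<open>B = {d > b}\<close>, the integrals \<open>D\<close> and \<open>D'\<close> of
  \<open>d^2\<close> over \<open>B\<close> and its complement \<open>B'\<close>, and the integral \<open>R\<close> of \<open>U^2\<close> over \<open>B' \<times> B'\<close>.
\<close>
lemma kernel_decomposition:
  assumes U: "bounded2 U" and sym: "\<And>x y. U x y = U y x"
    and U0: "\<And>x y. 0 \<le> U x y" and U1: "\<And>x y. U x y \<le> 1"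
    and p: "0 < p" and b: "0 < b" and t: "0 < t" "t \<le> 1"
  defines "E \<equiv> double_integral (\<lambda>x y. J_ent p (U x y))"
  shows "\<exists>S D D' \<Lambda> Q R. 0 \<le> S \<and> 0 \<le> D \<and> 0 \<le> \<Lambda> \<and> 0 \<le> R \<and>
    S \<le> E / t + p * t \<and> J_ent p 1 * Q \<le> E \<and> b\<^sup>2 * \<Lambda> \<le> Q \<and> J_ent p b * D' \<le> b\<^sup>2 * E \<and>
    R + 2 * D \<le> Q + \<Lambda>\<^sup>2 \<and>
    triple_integral (\<lambda>x y z. (p + U x y) * (p + U x z) * (p + U y z)) \<le>
      p ^ 3 + 3 * p\<^sup>2 * S + 3 * p * (D + D') + 3 * \<Lambda> * S + R * sqrt R"
proof -
  define d where "d = (\<lambda>x. \<integral>y. U x y \<partial>M)"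
  \<comment> \<open>\<open>c\<close> is the indicator of the set \<open>B\<close> of points of high
    degree, and \<open>V\<close> is \<open>U\<close> cut off to pairs outside
    \<open>B\<close>.\<close>
  define c :: "'a \<Rightarrow> real" where "c = (\<lambda>x. if d x > b then 1 else 0)"
  define V where "V = (\<lambda>x y. (1 - c x) * (1 - c y) * U x y)"
  define S where "S = double_integral U"
  define Q where "Q = double_integral (\<lambda>x y. (U x y)\<^sup>2)"
  define R where "R = double_integral (\<lambda>x y. (V x y)\<^sup>2)"
  define \<Lambda> where "\<Lambda> = (\<integral>x. c x \<partial>M)"
  define D where "D = (\<integral>x. c x * (d x)\<^sup>2 \<partial>M)"
  define D' where "D' = (\<integral>x. (1 - c x) * (d x)\<^sup>2 \<partial>M)"
  have U2: "bounded2 (\<lambda>x y. (U x y)\<^sup>2)"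
    unfolding power2_eq_square by (intro bounded2_mult U)
  have JU: "bounded2 (\<lambda>x y. J_ent p (U x y))"
    by (rule bounded2_J_ent[OF U U0 U1 p])
  have U_abs: "\<bar>U x y\<bar> \<le> 1" for x y using U0[of x y] U1[of x y] by simp
  have d0: "0 \<le> d x" for x by (simp add: d_def U0)
  have d1: "d x \<le> 1" for x
    using integral_abs_bound[of "U x" 1] U_abs by (auto simp: d_def)
  have [measurable]: "d \<in> borel_measurable M"
    using integrable_marginal[OF U] by (auto simp: d_def)
  have [measurable]: "c \<in> borel_measurable M" unfolding c_def by measurable
  have c01: "0 \<le> c x" "c x \<le> 1" "\<bar>c x\<bar> \<le> 1" for x by (auto simp: c_def)
  have d2_1: "(d x)\<^sup>2 \<le> 1" for x using d0 d1 by (simp add: power_le_one)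
  have int_c: "integrable M c" by (rule integrable_bounded) (use c01 in auto)
  have int_cd: "integrable M (\<lambda>x. c x * (d x)\<^sup>2)" "integrable M (\<lambda>x. (1 - c x) * (d x)\<^sup>2)"
    by (rule integrable_bounded[where K = 1]; use d2_1 in \<open>simp add: c_def\<close>)+
  have cx: "bounded2 (\<lambda>x y. c x)" and cy: "bounded2 (\<lambda>x y. c y)"
    by (rule bounded2_fst bounded2_snd; use c01 in auto)+
  have cx': "bounded2 (\<lambda>x y. 1 - c x)" and cy': "bounded2 (\<lambda>x y. 1 - c y)"
    by (rule bounded2_fst[where K=1] bounded2_snd[where K=1]; use c01 in auto)+
  have V: "bounded2 V" unfolding V_def by (intro bounded2_mult cx' cy' U)
  have V2: "bounded2 (\<lambda>x y. (V x y)\<^sup>2)"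
    unfolding power2_eq_square by (intro bounded2_mult V)
  have d2: "(d x)\<^sup>2 \<le> (\<integral>y. (U x y)\<^sup>2 \<partial>M)" if "x \<in> space M" for x
    unfolding d_def
    by (intro square_integral_le integrable1_slice[OF U that] integrable1_slice[OF U2 that])
  have S_le: "S \<le> E / t + p * t"
  proof -
    have "double_integral (\<lambda>x y. t * U x y + (- (p * t\<^sup>2))) \<le> E"
      unfolding E_def using J_ent_ge_linear[OF p U0 t]
      by (intro double_integral_mono JU bounded2_add bounded2_mult bounded2_const U) auto
    also have "double_integral (\<lambda>x y. t * U x y + (- (p * t\<^sup>2))) = t * S - p * t\<^sup>2"
      by (subst double_integral_add; (intro bounded2_mult bounded2_const U)?)
        (simp add: S_def prob_space)
    finally show ?thesis using t by (simp add: field_simps power2_eq_square)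
  qed
  have Q_le: "J_ent p 1 * Q \<le> E"
  proof -
    have "double_integral (\<lambda>x y. J_ent p 1 * (U x y)\<^sup>2) \<le> E"
      unfolding E_def using J_ent_quadratic[OF p U0 U1]
      by (intro double_integral_mono JU bounded2_mult bounded2_const U2) auto
    then show ?thesis by (simp add: Q_def)
  qed
  \<comment> \<open>Markov's inequality for the squared degree, which Cauchy-Schwarz bounds by the
    integral of \<open>U^2\<close> over a row.\<close>
  have \<Lambda>_le: "b\<^sup>2 * \<Lambda> \<le> Q"
  proof -
    have "(\<integral>x. b\<^sup>2 * c x \<partial>M) \<le> (\<integral>x. \<integral>y. (U x y)\<^sup>2 \<partial>M \<partial>M)"
    proof (intro integral_mono integrable_marginal U2)
      fix x assume x: "x \<in> space M"
      have "b\<^sup>2 * c x \<le> (d x)\<^sup>2" using b by (auto simp: c_def intro!: power_mono)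
      then show "b\<^sup>2 * c x \<le> (\<integral>y. (U x y)\<^sup>2 \<partial>M)" using d2[OF x] by simp
    qed (use int_c in simp)
    then show ?thesis by (simp add: \<Lambda>_def Q_def)
  qed
  \<comment> \<open>Off \<open>B\<close> the quadratic bound with endpoint \<open>b\<close> applies
    to the degree itself, and Jensen passes to the row of \<open>U\<close>. For \<open>p\<close>
    much smaller than \<open>b\<close> the ratio \<open>J_ent p b / b^2\<close> is about
    \<open>ln (b / p) / b\<close>; this extra factor \<open>1 / b\<close> over the ratio at 1 is
    what makes \<open>D'\<close> negligible.\<close>
  have D'_le: "J_ent p b * D' \<le> b\<^sup>2 * E"
  proof -
    have "(\<integral>x. J_ent p b * ((1 - c x) * (d x)\<^sup>2) \<partial>M) \<le> (\<integral>x. b\<^sup>2 * (\<integral>y. J_ent p (U x y) \<partial>M) \<partial>M)"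
    proof (intro integral_mono integrable_mult_right int_cd integrable_marginal JU)
      fix x assume x: "x \<in> space M"
      have jensen: "J_ent p (d x) \<le> (\<integral>y. J_ent p (U x y) \<partial>M)"
        unfolding d_def
        by (intro J_ent_jensen integrable1_slice[OF U x] integrable1_slice[OF JU x] U0 p)
      show "J_ent p b * ((1 - c x) * (d x)\<^sup>2) \<le> b\<^sup>2 * (\<integral>y. J_ent p (U x y) \<partial>M)"
      proof (cases "d x > b")
        case True
        have "0 \<le> (\<integral>y. J_ent p (U x y) \<partial>M)"
          using U0 p by (intro Bochner_Integration.integral_nonneg J_ent_nonneg)
        then show ?thesis using True by (simp add: c_def)
      next
        case False
        then have "J_ent p b * (d x)\<^sup>2 \<le> b\<^sup>2 * J_ent p (d x)"
          using d0 by (intro J_ent_quadratic p) auto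
        also have "\<dots> \<le> b\<^sup>2 * (\<integral>y. J_ent p (U x y) \<partial>M)"
          using jensen by (intro mult_left_mono) auto
        finally show ?thesis using False by (simp add: c_def)
      qed
    qed
    then show ?thesis by (simp add: D'_def E_def)
  qed
  \<comment> \<open>The mass of \<open>U^2\<close> splits into pairs off \<open>B\<close> and two
    strips over \<open>B\<close>, each strip carrying at least \<open>D\<close>. Only
    \<open>B \<times> B\<close> is counted twice, which costs at most its measure
    \<open>\<Lambda>^2\<close> as \<open>U \<le> 1\<close>.\<close>
  have R_le: "R + 2 * D \<le> Q + \<Lambda>\<^sup>2"
  proof -
    have cU: "double_integral (\<lambda>x y. c x * (U x y)\<^sup>2) \<ge> D"
      unfolding D_def
    proof (intro integral_mono int_cd integrable_marginal bounded2_mult cx U2)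
      fix x assume x: "x \<in> space M"
      show "c x * (d x)\<^sup>2 \<le> (\<integral>y. c x * (U x y)\<^sup>2 \<partial>M)"
        using d2[OF x] c01 by (simp add: mult_left_mono)
    qed
    have "double_integral (\<lambda>x y. c y * (U y x)\<^sup>2) = double_integral (\<lambda>x y. c x * (U x y)\<^sup>2)"
      by (rule double_integral_swap) (intro bounded2_mult cx U2)
    then have cU': "double_integral (\<lambda>x y. c y * (U x y)\<^sup>2) \<ge> D"
      using cU sym by simp
    have "double_integral (\<lambda>x y. (V x y)\<^sup>2 + (c x * (U x y)\<^sup>2 + c y * (U x y)\<^sup>2)) \<le>
        double_integral (\<lambda>x y. (U x y)\<^sup>2 + c x * c y)"
    proof (intro double_integral_mono bounded2_add V2 bounded2_mult cx cy U2)
      fix x y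
      have "(U x y)\<^sup>2 \<le> 1" using U0 U1 by (simp add: power_le_one)
      then show "(V x y)\<^sup>2 + (c x * (U x y)\<^sup>2 + c y * (U x y)\<^sup>2) \<le> (U x y)\<^sup>2 + c x * c y"
        by (auto simp: V_def c_def)
    qed
    moreover have "double_integral (\<lambda>x y. (V x y)\<^sup>2 + (c x * (U x y)\<^sup>2 + c y * (U x y)\<^sup>2)) =
        R + (double_integral (\<lambda>x y. c x * (U x y)\<^sup>2) + double_integral (\<lambda>x y. c y * (U x y)\<^sup>2))"
      unfolding R_def
      by (subst double_integral_add, (intro V2 bounded2_add bounded2_mult cx cy U2)+)+ simp
    moreover have "double_integral (\<lambda>x y. (U x y)\<^sup>2 + c x * c y) = Q + \<Lambda>\<^sup>2"
      unfolding Q_def \<Lambda>_def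
      by (subst double_integral_add, (intro bounded2_mult cx cy U2)+) (simp add: power2_eq_square)
    ultimately show ?thesis using cU cU' by linarith
  qed
  have tri: "triple_integral (\<lambda>x y z. U x y * U x z * U y z) \<le> 3 * \<Lambda> * S + R * sqrt R"
  proof -
    note bs = bounded3_add bounded3_mult bounded3_const bounded3_12[OF U] bounded3_13[OF U] bounded3_23[OF U]
      bounded3_12[OF V] bounded3_13[OF V] bounded3_23[OF V] bounded3_12[OF cx] bounded3_12[OF cy] bounded3_13[OF cy]
    \<comment> \<open>If some vertex lies in \<open>B\<close>, bound the two edges at it by 1; the
      opposite edge remains and the integral factors into \<open>\<Lambda> * S\<close>. Triangles
      avoiding \<open>B\<close> are those of \<open>V\<close>.\<close>
    have "triple_integral (\<lambda>x y z. U x y * U x z * U y z) \<le>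
      triple_integral (\<lambda>x y z. c x * U y z + (c y * U x z + (c z * U x y + V x y * V x z * V y z)))"
    proof (intro triple_integral_mono bs)
      fix x y z
      have *: "U x y * U x z * U y z \<le> U y z" "U x y * U x z * U y z \<le> U x z"
        "U x y * U x z * U y z \<le> U x y"
        using mult_mono[of "U x y * U x z" 1 "U y z" "U y z"] mult_mono[of "U x y * U y z" 1 "U x z" "U x z"]
          mult_mono[of "U x z * U y z" 1 "U x y" "U x y"]
        by (auto simp: U0 U1 mult_le_one ac_simps)
      show "U x y * U x z * U y z \<le> c x * U y z + (c y * U x z + (c z * U x y + V x y * V x z * V y z))"
        using * U0[of x y] U0[of x z] U0[of y z] by (auto simp: V_def c_def)
    qed
    also have "\<dots> = 3 * \<Lambda> * S + triple_integral (\<lambda>x y z. V x y * V x z * V y z)"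
      apply (subst triple_integral_add, (intro bs)+)+
      by (simp add: \<Lambda>_def S_def prob_space)
    also have "\<dots> \<le> 3 * \<Lambda> * S + R * sqrt R"
      using triangle_integral_le[OF V] by (simp add: R_def)
    finally show ?thesis .
  qed
  have "(\<integral>x. (d x)\<^sup>2 \<partial>M) = (\<integral>x. c x * (d x)\<^sup>2 + (1 - c x) * (d x)\<^sup>2 \<partial>M)"
    by (simp add: algebra_simps)
  also have "\<dots> = D + D'" unfolding D_def D'_def by (intro Bochner_Integration.integral_add int_cd)
  finally have dd: "(\<integral>x. (\<integral>y. U x y \<partial>M)\<^sup>2 \<partial>M) = D + D'" by (simp add: d_def)
  have "triple_integral (\<lambda>x y z. (p + U x y) * (p + U x z) * (p + U y z)) \<le>
      p ^ 3 + 3 * p\<^sup>2 * S + 3 * p * (D + D') + 3 * \<Lambda> * S + R * sqrt R"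
    using triangle_expansion[OF U sym, of p] tri unfolding dd S_def by linarith
  moreover have "0 \<le> S" "0 \<le> D" "0 \<le> \<Lambda>" "0 \<le> R"
    by (simp_all add: S_def D_def \<Lambda>_def R_def U0 c01)
  ultimately show ?thesis using S_le Q_le \<Lambda>_le D'_le R_le by blast
qed

end

section \<open>The lower bound for kernels\<close>

text \<open>
  The bounds of \<open>kernel_decomposition\<close> on \<open>S\<close>, \<open>\<Lambda>\<close> and \<open>D'\<close> for an entropy of at most \<open>C p^2 ln (1/p)\<close>, with
  \<open>t = p^(1/3)\<close> and \<open>b = p^(1/12)\<close>. Up to logarithms \<open>S\<close> is at most \<open>p^(4/3)\<close> and \<open>\<Lambda>\<close> at most \<open>p^2 / b^2\<close>, so that any
  exponent below \<open>1/6\<close> for \<open>b\<close> gives \<open>\<Lambda> S = o(p^3)\<close>.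
\<close>
definition linear_error :: "real \<Rightarrow> real \<Rightarrow> real" where
  "linear_error C p = C * p\<^sup>2 * ln (1 / p) / p powr (1/3) + p * p powr (1/3)"

definition hub_measure_error :: "real \<Rightarrow> real \<Rightarrow> real" where
  "hub_measure_error C p = C * p\<^sup>2 * ln (1 / p) / J_ent p 1 / (p powr (1/12))\<^sup>2"

definition low_degree_error :: "real \<Rightarrow> real \<Rightarrow> real" where
  "low_degree_error C p =
     (p powr (1/12))\<^sup>2 * (C * p\<^sup>2 * ln (1 / p)) / J_ent p (p powr (1/12))"

text \<open>The part of \<open>\<delta>\<close> left for the clique and hub terms, after subtracting
  in units of \<open>p^3\<close> the edge term, the paths centred at points of low degree, and the
  triangles meeting \<open>B\<close>.\<close>

definition effective_excess :: "real \<Rightarrow> real \<Rightarrow> real \<Rightarrow> real" where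
  "effective_excess C \<delta> p =
     \<delta> - (3 * linear_error C p / p + 3 * low_degree_error C p / p\<^sup>2 +
       3 * (hub_measure_error C p * linear_error C p) / p ^ 3)"

text \<open>The prefactor is the loss in comparing \<open>J_ent\<close> with a quadratic on the unit
  interval, and the subtracted square comes from the double counting on
  \<open>B \<times> B\<close>.\<close>

definition entropy_lower_bound :: "real \<Rightarrow> real \<Rightarrow> real \<Rightarrow> real" where
  "entropy_lower_bound C \<delta> p =
     J_ent p 1 / ln (1 / p) *
       (min (effective_excess C \<delta> p powr (2/3) / 2) (effective_excess C \<delta> p / 3) -
        (hub_measure_error C p)\<^sup>2 / (2 * p\<^sup>2))"

text \<open>Up to constants and logarithms the three error terms are of order
  \<open>p^(1/3)\<close>, \<open>p^(1/12)\<close> and \<open>p^(1/6)\<close>.\<close>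

lemma effective_excess_tendsto:
  assumes "C > 0"
  shows "(effective_excess C \<delta> \<longlongrightarrow> \<delta>) (at_right 0)"
proof -
  have 1: "((\<lambda>p. 3 * linear_error C p / p) \<longlongrightarrow> 0) (at_right 0)"
    unfolding linear_error_def using assms by real_asymp
  have 2: "((\<lambda>p. 3 * low_degree_error C p / p\<^sup>2) \<longlongrightarrow> 0) (at_right 0)"
    unfolding low_degree_error_def J_ent_def using assms by real_asymp
  have 3: "((\<lambda>p. 3 * (hub_measure_error C p * linear_error C p) / p ^ 3) \<longlongrightarrow> 0) (at_right 0)"
    unfolding hub_measure_error_def linear_error_def J_ent_def using assms by real_asymp
  have "(effective_excess C \<delta> \<longlongrightarrow> \<delta> - (0 + 0 + 0)) (at_right 0)"
    unfolding effective_excess_def[abs_def] by (intro tendsto_intros 1 2 3)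
  then show ?thesis by simp
qed

text \<open>\<open>J_ent p 1\<close> is asymptotic to \<open>ln (1 / p)\<close>, and
  \<open>hub_measure_error\<close> is of order \<open>p^(11/6)\<close>, so its square is negligible
  against \<open>p^2\<close>.\<close>

lemma entropy_lower_bound_tendsto:
  assumes "C > 0" "\<delta> > 0"
  shows "(entropy_lower_bound C \<delta> \<longlongrightarrow> min (\<delta> powr (2/3) / 2) (\<delta> / 3)) (at_right 0)"
proof -
  have 1: "((\<lambda>p. J_ent p 1 / ln (1 / p)) \<longlongrightarrow> 1) (at_right 0)"
    unfolding J_ent_def by real_asymp
  have 2: "((\<lambda>p. (hub_measure_error C p)\<^sup>2 / (2 * p\<^sup>2)) \<longlongrightarrow> 0) (at_right 0)"
    unfolding hub_measure_error_def J_ent_def using assms by real_asymp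
  have "(entropy_lower_bound C \<delta> \<longlongrightarrow> 1 * (min (\<delta> powr (2/3) / 2) (\<delta> / 3) - 0)) (at_right 0)"
    unfolding entropy_lower_bound_def[abs_def] using assms
    by (intro tendsto_intros 1 2 effective_excess_tendsto) auto
  then show ?thesis by simp
qed

text \<open>The upper bound on \<open>E\<close> turns \<open>S\<close>, \<open>\<Lambda>\<close> and
  \<open>D'\<close> into explicit errors. Dividing the triangle inequality by \<open>p^3\<close>
  leaves the constraint of \<open>min_variational\<close>, whose conclusion bounds
  \<open>R + 2 * D\<close> from below, while \<open>kernel_decomposition\<close> bounds it from
  above by \<open>Q + \<Lambda>^2\<close>.\<close>

lemma (in prob_space) kernel_entropy_ge:
  assumes U: "bounded2 U" "\<And>x y. U x y = U y x" "\<And>x y. 0 \<le> U x y" "\<And>x y. U x y \<le> 1"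
    and p: "0 < p" "p < 1" and excess: "0 < effective_excess C \<delta> p"
    and tri: "(1 + \<delta>) * p ^ 3 \<le> triple_integral (\<lambda>x y z. (p + U x y) * (p + U x z) * (p + U y z))"
  defines "E \<equiv> double_integral (\<lambda>x y. J_ent p (U x y))"
  assumes E: "E \<le> C * p\<^sup>2 * ln (1 / p)"
  shows "entropy_lower_bound C \<delta> p \<le> E / (2 * p\<^sup>2 * ln (1 / p))"
proof -
  define L b t where "L = ln (1 / p)" "b = p powr (1/12)" "t = p powr (1/3)"
  have L: "0 < L" using p by (simp add: L_b_t_def)
  have b: "0 < b" using p by (simp add: L_b_t_def)
  have t: "0 < t" "t \<le> 1" using p by (auto simp: L_b_t_def powr_le1)
  have \<kappa>: "0 < J_ent p 1" and Jb: "0 < J_ent p b" using p b by (auto intro: J_ent_pos)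
  obtain S D D' \<Lambda> Q R where nonneg: "0 \<le> S" "0 \<le> D" "0 \<le> \<Lambda>" "0 \<le> R"
    and S: "S \<le> E / t + p * t" and Q: "J_ent p 1 * Q \<le> E" and \<Lambda>: "b\<^sup>2 * \<Lambda> \<le> Q"
    and D': "J_ent p b * D' \<le> b\<^sup>2 * E" and R: "R + 2 * D \<le> Q + \<Lambda>\<^sup>2"
    and T: "triple_integral (\<lambda>x y z. (p + U x y) * (p + U x z) * (p + U y z)) \<le>
      p ^ 3 + 3 * p\<^sup>2 * S + 3 * p * (D + D') + 3 * \<Lambda> * S + R * sqrt R"
    using kernel_decomposition[OF U p(1) b t] unfolding E_def by blast
  have S': "S \<le> linear_error C p"
  proof -
    have "E / t \<le> C * p\<^sup>2 * L / t"
      using E t by (intro divide_right_mono) (auto simp: L_b_t_def)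
    with S show ?thesis unfolding linear_error_def L_b_t_def by linarith
  qed
  have Q': "Q \<le> E / J_ent p 1" using Q \<kappa> by (simp add: field_simps)
  have \<Lambda>': "\<Lambda> \<le> hub_measure_error C p"
  proof -
    have "\<Lambda> \<le> Q / b\<^sup>2" using \<Lambda> b by (simp add: field_simps)
    also have "\<dots> \<le> C * p\<^sup>2 * L / J_ent p 1 / b\<^sup>2"
    proof (rule divide_right_mono)
      have "E / J_ent p 1 \<le> C * p\<^sup>2 * L / J_ent p 1"
        using E \<kappa> by (intro divide_right_mono) (auto simp: L_b_t_def)
      with Q' show "Q \<le> C * p\<^sup>2 * L / J_ent p 1" by linarith
    qed simp
    finally show ?thesis by (simp add: hub_measure_error_def L_b_t_def)
  qed
  have D'': "D' \<le> low_degree_error C p"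
  proof -
    have "D' \<le> b\<^sup>2 * E / J_ent p b" using D' Jb by (simp add: field_simps)
    also have "\<dots> \<le> b\<^sup>2 * (C * p\<^sup>2 * L) / J_ent p b"
      using E Jb by (intro divide_right_mono mult_left_mono) (auto simp: L_b_t_def)
    finally show ?thesis by (simp add: low_degree_error_def L_b_t_def)
  qed
  \<comment> \<open>The scaling under which \<open>R * sqrt R / p^3\<close> becomes
    \<open>r * sqrt r\<close> and \<open>3 * p * D / p^3\<close> becomes
    \<open>3 * \<theta>\<close>.\<close>
  define r \<theta> where "r = R / p\<^sup>2" "\<theta> = D / p\<^sup>2"
  have \<Lambda>S: "\<Lambda> * S \<le> hub_measure_error C p * linear_error C p"
    using S' \<Lambda>' nonneg by (intro mult_mono) auto
  have "\<delta> * p ^ 3 \<le> 3 * p\<^sup>2 * S + 3 * p * (D + D') + 3 * (\<Lambda> * S) + R * sqrt R"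
    using tri T by (simp add: algebra_simps)
  also have "\<dots> \<le> 3 * p\<^sup>2 * linear_error C p + 3 * p * (D + low_degree_error C p)
      + 3 * (hub_measure_error C p * linear_error C p) + R * sqrt R"
    using S' D'' \<Lambda>S p nonneg by (intro add_mono mult_left_mono) auto
  finally have "\<delta> * p ^ 3 / p ^ 3 \<le> (3 * p\<^sup>2 * linear_error C p + 3 * p * (D + low_degree_error C p)
      + 3 * (hub_measure_error C p * linear_error C p) + R * sqrt R) / p ^ 3"
    using p by (intro divide_right_mono) auto
  also have "\<dots> = 3 * linear_error C p / p + 3 * \<theta> + 3 * low_degree_error C p / p\<^sup>2 +
       3 * (hub_measure_error C p * linear_error C p) / p ^ 3 + R * sqrt R / p ^ 3"
    using p by (simp add: r_\<theta>_def add_divide_distrib distrib_left power2_eq_square power3_eq_cube)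
  also have "R * sqrt R / p ^ 3 = r * sqrt r"
    using p by (simp add: r_\<theta>_def real_sqrt_divide power2_eq_square power3_eq_cube)
  finally have "effective_excess C \<delta> p \<le> r * sqrt r + 3 * \<theta>"
    using p by (simp add: effective_excess_def)
  then have "min (effective_excess C \<delta> p powr (2/3) / 2) (effective_excess C \<delta> p / 3) \<le> r / 2 + \<theta>"
    using nonneg excess by (intro min_variational) (auto simp: r_\<theta>_def)
  also have "\<dots> = (R + 2 * D) / (2 * p\<^sup>2)"
    using p by (simp add: r_\<theta>_def field_simps)
  also have "\<dots> \<le> (E / J_ent p 1 + (hub_measure_error C p)\<^sup>2) / (2 * p\<^sup>2)"
  proof (rule divide_right_mono)
    have "\<Lambda>\<^sup>2 \<le> (hub_measure_error C p)\<^sup>2" using \<Lambda>' nonneg by (intro power_mono) auto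
    then show "R + 2 * D \<le> E / J_ent p 1 + (hub_measure_error C p)\<^sup>2" using R Q' by linarith
  qed simp
  finally have "min (effective_excess C \<delta> p powr (2/3) / 2) (effective_excess C \<delta> p / 3) -
      (hub_measure_error C p)\<^sup>2 / (2 * p\<^sup>2) \<le> E / J_ent p 1 / (2 * p\<^sup>2)"
    by (simp add: add_divide_distrib)
  then have "entropy_lower_bound C \<delta> p \<le> J_ent p 1 / L * (E / J_ent p 1 / (2 * p\<^sup>2))"
    unfolding entropy_lower_bound_def L_b_t_def(1)[symmetric]
    using \<kappa> L by (intro mult_left_mono) auto
  also have "\<dots> = E / (2 * p\<^sup>2 * L)" using \<kappa> L by simp
  finally show ?thesis by (simp add: L_b_t_def)
qed

section \<open>From graphons to Borel kernels\<close>

lemma integral_restrict_space_Times: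
  fixes f :: "'a::euclidean_space \<times> 'b::euclidean_space \<Rightarrow> real"
  assumes f: "f \<in> borel_measurable borel" and bound: "\<And>z. \<bar>f z\<bar> \<le> K"
    and A: "A \<in> sets borel" "bounded A" and B: "B \<in> sets borel" "bounded B"
  shows "integral\<^sup>L (restrict_space lborel (A \<times> B)) f =
    (\<integral>x. \<integral>y. f (x, y) \<partial>restrict_space lborel B \<partial>restrict_space lborel A)"
proof -
  have AB: "A \<times> B \<in> sets borel" using A B by (simp add: borel_prod[symmetric])
  have "emeasure lborel (A \<times> B) < \<infinity>"
    using A B by (intro emeasure_bounded_finite bounded_Times)
  then have int: "integrable lborel (\<lambda>z. indicator (A \<times> B) z *\<^sub>R f z)"
    using f AB bound by (intro integrableI_bounded_set_indicator[where B = K]) auto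
  have "integral\<^sup>L (restrict_space lborel (A \<times> B)) f = (\<integral>z. indicator (A \<times> B) z *\<^sub>R f z \<partial>lborel)"
    using AB by (intro integral_restrict_space) simp
  also have "\<dots> = (\<integral>x. \<integral>y. indicator (A \<times> B) (x, y) *\<^sub>R f (x, y) \<partial>lborel \<partial>lborel)"
    using lborel_pair.integral_fst'[of "\<lambda>z. indicator (A \<times> B) z *\<^sub>R f z"] int
    by (simp add: lborel_prod)
  also have "\<dots> = (\<integral>x. indicator A x *\<^sub>R (\<integral>y. indicator B y *\<^sub>R f (x, y) \<partial>lborel) \<partial>lborel)"
    by (simp add: indicator_times mult.assoc)
  also have "\<dots> = (\<integral>x. \<integral>y. f (x, y) \<partial>restrict_space lborel B \<partial>restrict_space lborel A)"
    using A B by (simp add: integral_restrict_space)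
  finally show ?thesis .
qed

text \<open>Completeness of Lebesgue measure makes \<open>h\<close>, cut off outside
  \<open>S\<close>, measurable, since its preimages differ from those of the Borel function by null
  sets. Hence an almost everywhere equal Borel function can replace it.\<close>

lemma integral_lebesgue_on_eq:
  fixes f h :: "'a::euclidean_space \<Rightarrow> real"
  assumes f: "f \<in> borel_measurable borel" and S: "S \<in> sets borel"
    and ae: "AE z in lborel. z \<in> S \<longrightarrow> h z = f z"
  shows "integral\<^sup>L (lebesgue_on S) h = integral\<^sup>L (restrict_space lborel S) f"
proof -
  define f0 h0 where "f0 = (\<lambda>z. indicator S z *\<^sub>R f z)" and "h0 = (\<lambda>z. indicator S z *\<^sub>R h z)"
  have f0: "f0 \<in> borel_measurable lborel" using f S by (simp add: f0_def)
  have "AE z in lborel. h0 z = f0 z"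
    using ae by eventually_elim (auto simp: f0_def h0_def indicator_def)
  then have ae0: "AE z in lebesgue. h0 z = f0 z" by (rule AE_completion)
  have f0': "f0 \<in> borel_measurable lebesgue" using f0 by (rule measurable_completion)
  have h0: "h0 \<in> borel_measurable lebesgue"
  proof (rule measurableI)
    fix T :: "real set" assume T: "T \<in> sets borel"
    show "h0 -` T \<inter> space lebesgue \<in> sets lebesgue"
    proof (rule completion.in_sets_AE)
      show "f0 -` T \<inter> space lebesgue \<in> sets lebesgue" using f0' T by (rule measurable_sets)
      show "AE x in lebesgue. (x \<in> f0 -` T \<inter> space lebesgue) = (x \<in> h0 -` T \<inter> space lebesgue)"
        using ae0 by eventually_elim auto
    qed auto
  qed auto
  have "integral\<^sup>L (lebesgue_on S) h = integral\<^sup>L lebesgue h0"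
    unfolding h0_def using S by (intro integral_restrict_space) auto
  also have "\<dots> = integral\<^sup>L lebesgue f0" using h0 f0' ae0 by (rule integral_cong_AE)
  also have "\<dots> = integral\<^sup>L lborel f0" using f0 by (rule integral_completion)
  also have "\<dots> = integral\<^sup>L (restrict_space lborel S) f"
    unfolding f0_def using S by (intro integral_restrict_space[symmetric]) auto
  finally show ?thesis .
qed

text \<open>The Borel version is used because Lebesgue measure on the square is the completion of a
  product and not a product of completions.\<close>

abbreviation unit_lborel :: "real measure" where
  "unit_lborel \<equiv> restrict_space lborel {0..1}"

interpretation unit_lborel: prob_space unit_lborel
  by (rule prob_space_restrict_space) auto

lemma AE_lborel_PairI:
  fixes P :: "'a::euclidean_space \<times> 'b::euclidean_space \<Rightarrow> bool"
  assumes "{w. P w} \<in> sets borel" "AE x in lborel. AE y in lborel. P (x, y)"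
  shows "AE w in lborel. P w"
proof -
  have "{w \<in> space (lborel \<Otimes>\<^sub>M lborel). P w} \<in> sets (lborel \<Otimes>\<^sub>M lborel)"
    unfolding lborel_prod using assms(1) by simp
  from lborel_pair.AE_pair_measure[OF this assms(2)] show ?thesis
    unfolding lborel_prod .
qed

text \<open>For almost every \<open>x\<close> the section of \<open>N\<close> at \<open>x\<close> is
  null, so almost all \<open>(y, z)\<close> avoid it in both coordinates, and almost all avoid
  \<open>N\<close> itself. Thus changing a graphon on a null set of pairs does not affect its
  triangles.\<close>

lemma AE_lborel_triple:
  fixes N :: "(real \<times> real) set"
  assumes N: "N \<in> null_sets lborel"
  shows "AE w in lborel. (fst w, fst (snd w)) \<notin> N \<and> (fst w, snd (snd w)) \<notin> N \<and> snd w \<notin> N"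
proof -
  have [measurable]: "N \<in> sets borel" using N by auto
  have AE_N: "AE w in lborel. w \<notin> N" using N by (rule AE_not_in)
  then have "AE w in lborel \<Otimes>\<^sub>M lborel. w \<notin> N" unfolding lborel_prod .
  then have AE1: "AE x in lborel. AE y in lborel. (x, y) \<notin> N" by (rule lborel_pair.AE_pair)
  have comp: "{w. g w \<notin> N} \<in> sets borel" if "continuous_on UNIV g" for g :: "'a::topological_space \<Rightarrow> real \<times> real"
  proof -
    have "g -` (- N) \<inter> space borel \<in> sets borel"
      using that by (intro measurable_sets[OF borel_measurable_continuous_onI]) auto
    then show ?thesis by (simp add: vimage_def)
  qed
  have "AE x in lborel. AE w in lborel. (x, fst w) \<notin> N \<and> (x, snd w) \<notin> N \<and> w \<notin> N"
    using AE1
  proof eventually_elim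
    case (elim x)
    have sets: "{w. (x, fst w) \<notin> N} \<in> sets borel" "{w. (x, snd w) \<notin> N} \<in> sets borel"
      by (intro comp continuous_intros)+
    have "AE y in lborel. AE z in lborel. (x, fst (y, z)) \<notin> N \<and> (x, snd (y, z)) \<notin> N"
      using elim by eventually_elim (use elim in auto)
    moreover have "{w. (x, fst w) \<notin> N \<and> (x, snd w) \<notin> N} \<in> sets borel"
      using sets.Int[OF sets] by (simp add: Int_def)
    ultimately have "AE w in lborel. (x, fst w) \<notin> N \<and> (x, snd w) \<notin> N"
      by (intro AE_lborel_PairI)
    then show ?case using AE_N by eventually_elim auto
  qed
  then have ae: "AE x in lborel. AE w in lborel.
      (fst (x, w), fst (snd (x, w))) \<notin> N \<and> (fst (x, w), snd (snd (x, w))) \<notin> N \<and> snd (x, w) \<notin> N"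
    by simp
  have "{w :: real \<times> real \<times> real. (fst w, fst (snd w)) \<notin> N} \<in> sets borel"
    "{w :: real \<times> real \<times> real. (fst w, snd (snd w)) \<notin> N} \<in> sets borel"
    "{w :: real \<times> real \<times> real. snd w \<notin> N} \<in> sets borel"
    by (intro comp continuous_intros)+
  then have "{w :: real \<times> real \<times> real. (fst w, fst (snd w)) \<notin> N} \<inter>
    ({w. (fst w, snd (snd w)) \<notin> N} \<inter> {w. snd w \<notin> N}) \<in> sets borel"
    by (intro sets.Int)
  then have "{w :: real \<times> real \<times> real. (fst w, fst (snd w)) \<notin> N \<and> (fst w, snd (snd w)) \<notin> N \<and> snd w \<notin> N}
      \<in> sets borel"
    by (simp add: Int_def)
  then show ?thesis using ae by (rule AE_lborel_PairI)
qed

text \<open>A representative of a graphon with symmetry and range imposed on the whole plane, so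
  that it fits the calculus of \<open>bounded2\<close> and \<open>bounded3\<close>.\<close>

definition borel_kernel :: "(real \<Rightarrow> real \<Rightarrow> real) \<Rightarrow> bool" where
  "borel_kernel V \<longleftrightarrow> (\<lambda>(x, y). V x y) \<in> borel_measurable borel \<and>
     (\<forall>x y. V x y = V y x) \<and> (\<forall>x y. 0 \<le> V x y \<and> V x y \<le> 1)"

lemma borel_kernel_bounded2:
  assumes "borel_kernel V"
  shows "unit_lborel.bounded2 V"
proof -
  have id: "id \<in> measurable unit_lborel borel"
    by (intro measurable_restrict_space1) auto
  have "(\<lambda>w. (id (fst w), id (snd w))) \<in> measurable (unit_lborel \<Otimes>\<^sub>M unit_lborel) (borel \<Otimes>\<^sub>M borel)"
    by (intro measurable_Pair measurable_compose[OF measurable_fst id] measurable_compose[OF measurable_snd id])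
  then have incl: "(\<lambda>w. w) \<in> measurable (unit_lborel \<Otimes>\<^sub>M unit_lborel) (borel :: (real \<times> real) measure)"
    by (simp add: borel_prod)
  have "(\<lambda>(x, y). V x y) \<in> borel_measurable borel"
    using assms unfolding borel_kernel_def by blast
  with incl have "(\<lambda>(x, y). V x y) \<in> borel_measurable (unit_lborel \<Otimes>\<^sub>M unit_lborel)"
    by (rule measurable_compose)
  moreover have "0 \<le> V x y" "V x y \<le> 1" for x y using assms by (auto simp: borel_kernel_def)
  then have "\<bar>V x y\<bar> \<le> 1" for x y by (simp only: abs_of_nonneg)
  ultimately show ?thesis unfolding unit_lborel.bounded2_def by blast
qed

text \<open>Both summands have the form \<open>y * ln (y / q)\<close> with \<open>y\<close> in the
  unit interval, hence are at most \<open>ln (1 / q)\<close>. This crude bound serves only for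
  integrability.\<close>

lemma I_ent_le:
  assumes "0 < p" "p < 1" "0 \<le> x" "x \<le> 1"
  shows "I_ent p x \<le> ln (1 / p) + ln (1 / (1 - p))"
proof -
  have *: "y * ln (y / q) \<le> ln (1 / q)" if "0 \<le> y" "y \<le> 1" "0 < q" "q < 1" for y q :: real
  proof (cases "y = 0")
    case False
    then have "ln (y / q) \<le> ln (1 / q)" using that by (intro ln_mono divide_right_mono) auto
    then have "y * ln (y / q) \<le> y * ln (1 / q)" using that by (intro mult_left_mono) auto
    also have "\<dots> \<le> 1 * ln (1 / q)" using that by (intro mult_right_mono) auto
    finally show ?thesis by simp
  qed (use that in simp)
  show ?thesis unfolding I_ent_def
    using *[of x p] *[of "1 - x" "1 - p"] assms by (intro add_mono) auto
qed

lemma I_ent_borel [measurable]: "I_ent p \<in> borel_measurable borel"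
  unfolding I_ent_def[abs_def] by measurable

lemma borel_kernel_bounded2_I_ent:
  assumes "borel_kernel V" "0 < p" "p < 1"
  shows "unit_lborel.bounded2 (\<lambda>x y. I_ent p (V x y))"
proof -
  have [measurable]: "(\<lambda>(x, y). V x y) \<in> borel_measurable (unit_lborel \<Otimes>\<^sub>M unit_lborel)"
    using borel_kernel_bounded2[OF assms(1)] by (simp add: unit_lborel.bounded2_def)
  have "(\<lambda>w. I_ent p ((\<lambda>(x, y). V x y) w)) \<in> borel_measurable (unit_lborel \<Otimes>\<^sub>M unit_lborel)"
    by measurable
  moreover have "\<bar>I_ent p (V x y)\<bar> \<le> ln (1 / p) + ln (1 / (1 - p))" for x y
    using I_ent_le[of p "V x y"] I_ent_nonneg[of p "V x y"] assms by (auto simp: borel_kernel_def)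
  ultimately show ?thesis by (auto simp: unit_lborel.bounded2_def case_prod_unfold)
qed

text \<open>Entropy needs \<open>W = V\<close> at almost every pair, triangle density at almost
  every triple on all three edges; Fubini then gives the iterated integrals. It is used both for a
  Borel version \<open>V\<close> of an arbitrary graphon and with \<open>W = V\<close> for explicit
  step graphons.\<close>

lemma graphon_integrals:
  assumes V: "borel_kernel V"
    and ae: "AE z in lborel. z \<in> {0..1} \<times> {0..1} \<longrightarrow> W (fst z) (snd z) = V (fst z) (snd z)"
  shows tri_density_eq:
      "tri_density W = unit_lborel.triple_integral (\<lambda>x y z. V x y * V x z * V y z)"
    and graphon_entropy_eq: "0 < p \<Longrightarrow> p < 1 \<Longrightarrow>
      graphon_entropy p W = unit_lborel.double_integral (\<lambda>x y. I_ent p (V x y))"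
proof -
  have Vm: "(\<lambda>z. V (fst z) (snd z)) \<in> borel_measurable borel"
    using V by (simp add: borel_kernel_def case_prod_unfold)
  have V01: "0 \<le> V x y" "V x y \<le> 1" for x y using V by (auto simp: borel_kernel_def)
  have sets2: "{0..1} \<times> {0..1} \<in> sets (borel :: (real \<times> real) measure)"
    by (simp add: borel_prod[symmetric])
  have sets3: "{0..1} \<times> {0..1} \<times> {0..1} \<in> sets (borel :: (real \<times> real \<times> real) measure)"
    using sets2 by (simp add: borel_prod[symmetric])
  show "graphon_entropy p W = unit_lborel.double_integral (\<lambda>x y. I_ent p (V x y))"
    if p: "0 < p" "p < 1"
  proof -
    let ?f = "\<lambda>z. I_ent p (V (fst z) (snd z))"
    have f: "?f \<in> borel_measurable borel" using Vm by measurable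
    have "graphon_entropy p W = integral\<^sup>L (restrict_space lborel ({0..1} \<times> {0..1})) ?f"
      unfolding graphon_entropy_def using ae
      by (intro integral_lebesgue_on_eq f sets2) (auto simp: case_prod_unfold elim!: eventually_mono)
    also have "\<dots> = unit_lborel.double_integral (\<lambda>x y. I_ent p (V x y))"
      using I_ent_le[OF p V01] I_ent_nonneg[OF p V01]
      by (subst integral_restrict_space_Times[OF f, where K = "ln (1 / p) + ln (1 / (1 - p))"]) auto
    finally show ?thesis .
  qed
  let ?g = "\<lambda>w. V (fst w) (fst (snd w)) * V (fst w) (snd (snd w)) * V (fst (snd w)) (snd (snd w))"
  have g_bound: "\<bar>?g w\<bar> \<le> 1" for w
    using V01 by (auto simp: abs_mult intro!: mult_le_one)
  have comp: "(\<lambda>w. V (a w) (b w)) \<in> borel_measurable borel"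
    if "continuous_on UNIV a" "continuous_on UNIV b" for a b :: "real \<times> real \<times> real \<Rightarrow> real"
    using measurable_compose[OF borel_measurable_continuous_onI Vm, of "\<lambda>w. (a w, b w)"] that
    by (simp add: continuous_on_Pair)
  have g: "?g \<in> borel_measurable borel"
    by (intro borel_measurable_times comp continuous_intros)
  obtain N where N: "N \<in> null_sets lborel"
    and WV: "\<And>x y. (x, y) \<notin> N \<Longrightarrow> x \<in> {0..1} \<Longrightarrow> y \<in> {0..1} \<Longrightarrow> W x y = V x y"
  proof -
    from ae obtain N where "N \<in> null_sets lborel"
      "{z \<in> space lborel. \<not> (z \<in> {0..1} \<times> {0..1} \<longrightarrow> W (fst z) (snd z) = V (fst z) (snd z))} \<subseteq> N"
      by (auto simp: eventually_ae_filter)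
    then show ?thesis by (intro that[of N]) fastforce+
  qed
  have "tri_density W = integral\<^sup>L (restrict_space lborel ({0..1} \<times> {0..1} \<times> {0..1})) ?g"
    unfolding tri_density_def
  proof (intro integral_lebesgue_on_eq g sets3)
    show "AE w in lborel. w \<in> {0..1} \<times> {0..1} \<times> {0..1} \<longrightarrow>
        (case w of (x, y, z) \<Rightarrow> W x y * W x z * W y z) = ?g w"
      using AE_lborel_triple[OF N] by eventually_elim (auto simp: WV)
  qed
  also have "\<dots> = (\<integral>x. integral\<^sup>L (restrict_space lborel ({0..1} \<times> {0..1})) (\<lambda>w. ?g (x, w)) \<partial>unit_lborel)"
    using g_bound sets2
    by (subst integral_restrict_space_Times[OF g, where K = 1]) (auto intro: bounded_Times)
  also have "\<dots> = unit_lborel.triple_integral (\<lambda>x y z. V x y * V x z * V y z)"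
  proof (intro Bochner_Integration.integral_cong refl)
    fix x
    have "(\<lambda>w. ?g (x, w)) \<in> borel_measurable borel"
      using measurable_compose[OF borel_measurable_continuous_onI g, of "\<lambda>w. (x, w)"]
      by (simp add: continuous_on_Pair)
    then show "integral\<^sup>L (restrict_space lborel ({0..1} \<times> {0..1})) (\<lambda>w. ?g (x, w)) =
        (\<integral>y. \<integral>z. V x y * V x z * V y z \<partial>unit_lborel \<partial>unit_lborel)"
      using g_bound[of "(x, _)"]
      by (subst integral_restrict_space_Times[where K = 1]) auto
  qed
  finally show "tri_density W = unit_lborel.triple_integral (\<lambda>x y z. V x y * V x z * V y z)" .
qed

text \<open>Take a Borel version of \<open>W\<close> extended by 0, read it at
  \<open>(min x y, max x y)\<close> and clamp it to the unit interval; this forces symmetry and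
  range everywhere.\<close>

lemma graphon_borel_version:
  assumes "graphon W"
  obtains V where "borel_kernel V"
    "AE z in lborel. z \<in> {0..1} \<times> {0..1} \<longrightarrow> W (fst z) (snd z) = V (fst z) (snd z)"
proof -
  let ?S = "{0..1} \<times> {0..1} :: (real \<times> real) set"
  define g where "g = (\<lambda>z. if z \<in> ?S then (\<lambda>(x, y). W x y) z else 0)"
  have "?S \<in> sets (borel :: (real \<times> real) measure)"
    by (simp add: borel_prod[symmetric])
  then have "?S \<in> sets lebesgue" by auto
  then have "g \<in> borel_measurable lebesgue"
    using assms unfolding g_def graphon_def by (simp add: borel_measurable_if)
  then obtain g' where g': "g' \<in> borel_measurable lborel" and "AE z in lborel. g z = g' z"
    using completion_ex_borel_measurable_real by blast
  then obtain N where N: "N \<in> null_sets lborel" and eq: "\<And>z. z \<notin> N \<Longrightarrow> g z = g' z"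
    by (auto simp: eventually_ae_filter)
  have [measurable]: "N \<in> sets borel" using N by auto
  define V where "V = (\<lambda>x y. max 0 (min 1 (g' (min x y, max x y))))"
  have "(\<lambda>z :: real \<times> real. (min (fst z) (snd z), max (fst z) (snd z))) \<in> borel_measurable borel"
    by (intro borel_measurable_continuous_onI continuous_intros)
  from measurable_compose[OF this, of g' borel] g'
  have "(\<lambda>z. g' (min (fst z) (snd z), max (fst z) (snd z))) \<in> borel_measurable borel"
    by simp
  then have "(\<lambda>(x, y). V x y) \<in> borel_measurable borel"
    unfolding V_def case_prod_unfold by (intro borel_measurable_max borel_measurable_min) simp_all
  moreover have "V x y = V y x" "0 \<le> V x y" "V x y \<le> 1" for x y
    by (simp_all add: V_def min.commute[of x y] max.commute[of x y])
  ultimately have "borel_kernel V"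
    unfolding borel_kernel_def by blast
  moreover have "AE z in lborel. z \<in> ?S \<longrightarrow> W (fst z) (snd z) = V (fst z) (snd z)"
  proof -
    \<comment> \<open>Below the diagonal \<open>V\<close> reads the mirror image of its argument, so
      the reflection of the exceptional set must be shown null as well.\<close>
    have swap_sets: "{z. (snd z, fst z) \<notin> N} \<in> sets borel"
    proof -
      have "(\<lambda>z :: real \<times> real. (snd z, fst z)) -` (- N) \<inter> space borel \<in> sets borel"
        by (intro measurable_sets[OF borel_measurable_continuous_onI] continuous_intros) auto
      then show ?thesis by (simp add: vimage_def)
    qed
    have "AE z in lborel \<Otimes>\<^sub>M lborel. z \<notin> N" using AE_not_in[OF N] unfolding lborel_prod .
    then have "AE x in lborel. AE y in lborel. (x, y) \<notin> N" by (rule lborel_pair.AE_pair)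
    moreover have "{z \<in> space (lborel \<Otimes>\<^sub>M lborel). (fst z, snd z) \<notin> N} \<in> sets (lborel \<Otimes>\<^sub>M lborel)"
      unfolding lborel_prod by simp
    ultimately have "AE x in lborel. AE y in lborel. (y, x) \<notin> N"
      using lborel_pair.AE_commute[of "\<lambda>y x. (y, x) \<notin> N"] by blast
    then have "AE z in lborel. (snd z, fst z) \<notin> N"
      by (intro AE_lborel_PairI swap_sets) simp
    with AE_not_in[OF N] show ?thesis
    proof eventually_elim
      case (elim z)
      obtain x y where z: "z = (x, y)" by (cases z)
      show ?case
      proof
        assume "z \<in> ?S"
        then have xy: "x \<in> {0..1}" "y \<in> {0..1}" using z by auto
        then have "g (x, y) = W x y" "g (y, x) = W x y" "W x y \<in> {0..1}"
          using assms unfolding graphon_def g_def by auto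
        moreover have "g (x, y) = g' (x, y)" "g (y, x) = g' (y, x)"
          using eq elim z by auto
        ultimately show "W (fst z) (snd z) = V (fst z) (snd z)"
          using z by (auto simp: V_def min_def max_def)
      qed
    qed
  qed
  ultimately show ?thesis by (rule that)
qed

section \<open>Bounds on the variational problem\<close>

lemma borel_kernel_graphon:
  assumes "borel_kernel V"
  shows "graphon V"
proof -
  have "(\<lambda>(x, y). V x y) \<in> borel_measurable lborel"
    using assms unfolding borel_kernel_def by simp
  then have "(\<lambda>(x, y). V x y) \<in> borel_measurable (lebesgue_on ({0..1} \<times> {0..1}))"
    by (intro measurable_restrict_space1 measurable_completion)
  moreover have "V x y = V y x" "V x y \<in> {0..1}" for x y
    using assms unfolding borel_kernel_def by (blast, auto)
  ultimately show ?thesis unfolding graphon_def by blast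
qed

lemma graphon_entropy_nonneg:
  assumes "graphon W" "0 < p" "p < 1"
  shows "0 \<le> graphon_entropy p W"
  unfolding graphon_entropy_def
  using assms I_ent_nonneg[OF assms(2,3)]
  by (intro Bochner_Integration.integral_nonneg) (auto simp: graphon_def)

lemma phi_le:
  assumes "graphon W" "(1 + \<delta>) * p ^ 3 \<le> tri_density W" "0 < p" "p < 1"
  shows "phi p \<delta> \<le> graphon_entropy p W / 2"
  unfolding phi_def
proof (rule cInf_lower)
  show "bdd_below {graphon_entropy p W / 2 |W. graphon W \<and> (1 + \<delta>) * p ^ 3 \<le> tri_density W}"
    by (rule bdd_belowI[of _ 0]) (use graphon_entropy_nonneg[OF _ assms(3,4)] in fastforce)
qed (use assms in auto)

text \<open>Passing to \<open>p + U\<close> raises the triangle density, while the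
  \<open>J_ent\<close> integral \<open>E\<close> of \<open>U\<close> is at most the entropy. If
  \<open>E\<close> exceeds \<open>C * p^2 * ln (1 / p)\<close>, the first entry of the minimum is a
  bound at once; otherwise \<open>kernel_entropy_ge\<close> applies.\<close>

lemma graphon_entropy_ge:
  assumes W: "graphon W" and tri: "(1 + \<delta>) * p ^ 3 \<le> tri_density W"
    and p: "0 < p" "p < 1" and excess: "0 < effective_excess C \<delta> p"
  shows "min (C / 2) (entropy_lower_bound C \<delta> p) * (p\<^sup>2 * ln (1 / p)) \<le> graphon_entropy p W / 2"
proof -
  obtain V where V: "borel_kernel V"
    and ae: "AE z in lborel. z \<in> {0..1} \<times> {0..1} \<longrightarrow> W (fst z) (snd z) = V (fst z) (snd z)"
    using graphon_borel_version[OF W] .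
  have V01: "0 \<le> V x y" "V x y \<le> 1" and Vsym: "V x y = V y x" for x y
    using V unfolding borel_kernel_def by blast+
  have V2: "unit_lborel.bounded2 V" by (rule borel_kernel_bounded2[OF V])
  define U where "U = (\<lambda>x y. max (V x y - p) 0)"
  have U01: "0 \<le> U x y" "U x y \<le> 1" for x y using V01[of x y] p by (auto simp: U_def)
  have Usym: "U x y = U y x" for x y using Vsym[of x y] by (simp add: U_def)
  have U2: "unit_lborel.bounded2 U"
  proof -
    have [measurable]: "(\<lambda>(x, y). V x y) \<in> borel_measurable (unit_lborel \<Otimes>\<^sub>M unit_lborel)"
      using V2 unfolding unit_lborel.bounded2_def by blast
    have "(\<lambda>w. max ((\<lambda>(x, y). V x y) w - p) 0) \<in> borel_measurable (unit_lborel \<Otimes>\<^sub>M unit_lborel)"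
      by measurable
    also have "(\<lambda>w. max ((\<lambda>(x, y). V x y) w - p) 0) = (\<lambda>(x, y). U x y)"
      by (auto simp: U_def)
    finally have "(\<lambda>(x, y). U x y) \<in> borel_measurable (unit_lborel \<Otimes>\<^sub>M unit_lborel)" .
    moreover have "\<bar>U x y\<bar> \<le> 1" for x y using U01[of x y] by simp
    ultimately show ?thesis unfolding unit_lborel.bounded2_def by blast
  qed
  have VU: "V x y \<le> p + U x y" for x y by (simp add: U_def)
  define E where "E = unit_lborel.double_integral (\<lambda>x y. J_ent p (U x y))"
  have E_le: "E \<le> graphon_entropy p W"
    unfolding E_def graphon_entropy_eq[OF V ae p]
    using J_ent_le_I_ent[OF p V01]
    by (intro unit_lborel.double_integral_mono unit_lborel.bounded2_J_ent[OF U2 U01 p(1)]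
        borel_kernel_bounded2_I_ent V p) (simp add: U_def)
  have L: "0 < p\<^sup>2 * ln (1 / p)" using p by simp
  show ?thesis
  proof (cases "E \<le> C * p\<^sup>2 * ln (1 / p)")
    case False
    have "min (C / 2) (entropy_lower_bound C \<delta> p) * (p\<^sup>2 * ln (1 / p)) \<le> C / 2 * (p\<^sup>2 * ln (1 / p))"
      using L by (intro mult_right_mono) auto
    also have "\<dots> \<le> graphon_entropy p W / 2" using False E_le by (simp add: mult.assoc)
    finally show ?thesis .
  next
    case True
    note bs = unit_lborel.bounded3_mult unit_lborel.bounded3_add unit_lborel.bounded3_const
      unit_lborel.bounded3_12[OF V2] unit_lborel.bounded3_13[OF V2] unit_lborel.bounded3_23[OF V2]
      unit_lborel.bounded3_12[OF U2] unit_lborel.bounded3_13[OF U2] unit_lborel.bounded3_23[OF U2]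
    have "tri_density W \<le>
        unit_lborel.triple_integral (\<lambda>x y z. (p + U x y) * (p + U x z) * (p + U y z))"
      unfolding tri_density_eq[OF V ae]
    proof (intro unit_lborel.triple_integral_mono bs)
      show "V x y * V x z * V y z \<le> (p + U x y) * (p + U x z) * (p + U y z)" for x y z
        using VU V01 U01 p by (intro mult_mono mult_nonneg_nonneg add_nonneg_nonneg) auto
    qed
    with tri have "(1 + \<delta>) * p ^ 3 \<le>
        unit_lborel.triple_integral (\<lambda>x y z. (p + U x y) * (p + U x z) * (p + U y z))"
      by linarith
    from unit_lborel.kernel_entropy_ge[OF U2 Usym U01 p excess this] True
    have "entropy_lower_bound C \<delta> p \<le> E / (2 * p\<^sup>2 * ln (1 / p))" by (simp add: E_def)
    then have "entropy_lower_bound C \<delta> p * (p\<^sup>2 * ln (1 / p)) \<le> E / 2"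
      using L by (simp add: field_simps)
    moreover have "min (C / 2) (entropy_lower_bound C \<delta> p) * (p\<^sup>2 * ln (1 / p)) \<le>
        entropy_lower_bound C \<delta> p * (p\<^sup>2 * ln (1 / p))"
      using L by (intro mult_right_mono) auto
    ultimately show ?thesis using E_le by linarith
  qed
qed

section \<open>Upper bound from clique and hub step graphons\<close>

lemma prob_unit_interval: "unit_lborel.prob {0..1} = 1"
  using unit_lborel.prob_space by simp

definition initial_ind :: "real \<Rightarrow> real \<Rightarrow> real" where
  "initial_ind s x = (if x \<le> s then 1 else 0)"

lemma initial_ind_borel [measurable]: "initial_ind s \<in> borel_measurable borel"
  unfolding initial_ind_def[abs_def] by measurable

lemma initial_ind_bounds: "0 \<le> initial_ind s x" "initial_ind s x \<le> 1" "\<bar>initial_ind s x\<bar> \<le> 1"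
  by (auto simp: initial_ind_def)

lemma initial_ind_measurable: "initial_ind s \<in> borel_measurable unit_lborel"
  by (intro measurable_restrict_space1) simp

lemma integral_initial_ind:
  assumes "0 \<le> s" "s \<le> 1"
  shows "(\<integral>x. initial_ind s x \<partial>unit_lborel) = s"
proof -
  have "(\<integral>x. initial_ind s x \<partial>unit_lborel) = (\<integral>x. indicator {0..1} x *\<^sub>R initial_ind s x \<partial>lborel)"
    by (intro integral_restrict_space) simp
  also have "(\<lambda>x. indicator {0..1} x *\<^sub>R initial_ind s x) = indicator {0..s}"
    using assms by (auto simp: indicator_def initial_ind_def)
  also have "(\<integral>x. indicator {0..s} x \<partial>lborel) = s" using assms by simp
  finally show ?thesis .
qed

lemma initial_ind_bounded2:
  "unit_lborel.bounded2 (\<lambda>x y. initial_ind s x)" "unit_lborel.bounded2 (\<lambda>x y. initial_ind s y)"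
  by (rule unit_lborel.bounded2_fst unit_lborel.bounded2_snd;
      rule initial_ind_measurable initial_ind_bounds)+

lemmas initial_ind_bounded3 =
  unit_lborel.bounded3_12[OF initial_ind_bounded2(1)] unit_lborel.bounded3_12[OF initial_ind_bounded2(2)]
  unit_lborel.bounded3_13[OF initial_ind_bounded2(2)]

lemma cube_bounds:
  fixes p :: real
  assumes "0 < p" "p < 1"
  shows "p ^ 3 \<le> p" "p * p \<le> 1" "p ^ 3 \<le> p * p" "p ^ 3 \<le> 1" "p ^ 3 = p * p * p"
proof -
  show "p * p \<le> 1" "p ^ 3 \<le> 1"
    using assms by (simp_all add: mult_le_one power_le_one)
  show "p ^ 3 \<le> p" "p ^ 3 \<le> p * p"
    using assms power_decreasing[of 1 3 p] power_decreasing[of 2 3 p]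
    by (simp_all add: power2_eq_square)
qed (rule power3_eq_cube)

text \<open>The graphon is 1 on the square of side \<open>s\<close> and \<open>p\<close> elsewhere.
  A triple contributes at least \<open>p^3\<close>, and 1 if all its points are at most
  \<open>s\<close>; entropy arises only on the square, as \<open>I_ent p p = 0\<close>.\<close>

lemma phi_le_clique:
  assumes p: "0 < p" "p < 1" and s: "0 \<le> s" "s \<le> 1" and large: "\<delta> * p ^ 3 \<le> (1 - p ^ 3) * s ^ 3"
  shows "phi p \<delta> \<le> s\<^sup>2 / 2 * ln (1 / p)"
proof -
  let ?c = "initial_ind s"
  define V where "V = (\<lambda>x y. if x \<le> s \<and> y \<le> s then 1 else p)"
  have [measurable]: "(fst :: real \<times> real \<Rightarrow> real) \<in> borel_measurable borel"
    "(snd :: real \<times> real \<Rightarrow> real) \<in> borel_measurable borel"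
    by (intro borel_measurable_continuous_onI continuous_intros)+
  have "(\<lambda>(x, y). V x y) \<in> borel_measurable borel"
    unfolding V_def case_prod_unfold by measurable
  then have V: "borel_kernel V" using p by (auto simp: borel_kernel_def V_def)
  note V2 = borel_kernel_bounded2[OF V]
  note tri = tri_density_eq[OF V, of V] and ent = graphon_entropy_eq[OF V, of V, OF _ p]
  note bs = unit_lborel.bounded3_mult unit_lborel.bounded3_add unit_lborel.bounded3_const
    unit_lborel.bounded3_12[OF V2] unit_lborel.bounded3_13[OF V2] unit_lborel.bounded3_23[OF V2]
    initial_ind_bounded3
  have "(1 + \<delta>) * p ^ 3 \<le> p ^ 3 + (1 - p ^ 3) * s ^ 3"
    using large by (simp add: algebra_simps)
  also have "\<dots> = unit_lborel.triple_integral (\<lambda>x y z. p ^ 3 + (1 - p ^ 3) * (?c x * ?c y * ?c z))"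
    by (subst unit_lborel.triple_integral_add, (intro bs)+)
      (simp add: integral_initial_ind s prob_unit_interval power3_eq_cube)
  also have "\<dots> \<le> unit_lborel.triple_integral (\<lambda>x y z. V x y * V x z * V y z)"
  proof (intro unit_lborel.triple_integral_mono bs)
    fix x y z
    show "p ^ 3 + (1 - p ^ 3) * (?c x * ?c y * ?c z) \<le> V x y * V x z * V y z"
      using cube_bounds[OF p] by (simp add: V_def initial_ind_def)
  qed
  finally have tri': "(1 + \<delta>) * p ^ 3 \<le> tri_density V" by (simp add: tri)
  have "graphon_entropy p V = unit_lborel.double_integral (\<lambda>x y. I_ent p (V x y))"
    by (simp add: ent)
  also have "(\<lambda>x y. I_ent p (V x y)) = (\<lambda>x y. ln (1 / p) * (?c x * ?c y))"
    using p by (auto simp: V_def initial_ind_def I_ent_self I_ent_one fun_eq_iff)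
  also have "unit_lborel.double_integral (\<lambda>x y. ln (1 / p) * (?c x * ?c y)) = ln (1 / p) * (s * s)"
    by (simp add: integral_initial_ind s)
  finally have "graphon_entropy p V = s\<^sup>2 * ln (1 / p)" by (simp add: power2_eq_square)
  then show ?thesis using phi_le[OF borel_kernel_graphon[OF V] tri' p] by simp
qed

text \<open>The graphon is 1 when some coordinate is at most \<open>s\<close> and \<open>p\<close>
  elsewhere. Triples with exactly one point in the hub have measure \<open>3 * s * (1 - s)^2\<close>
  and contribute \<open>p\<close> instead of \<open>p^3\<close>; other triples are bounded below by
  \<open>p^3\<close>. The two strips of the hub carry entropy at most
  \<open>2 * s * ln (1 / p)\<close>.\<close>

lemma phi_le_hub:
  assumes p: "0 < p" "p < 1" and s: "0 \<le> s" "s \<le> 1"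
    and large: "\<delta> * p ^ 3 \<le> (p - p ^ 3) * (3 * (s * (1 - s)\<^sup>2))"
  shows "phi p \<delta> \<le> s * ln (1 / p)"
proof -
  let ?c = "initial_ind s"
  define e where "e = (\<lambda>x. 1 - ?c x)"
  define V where "V = (\<lambda>x y. if x \<le> s \<or> y \<le> s then 1 else p)"
  have [measurable]: "(fst :: real \<times> real \<Rightarrow> real) \<in> borel_measurable borel"
    "(snd :: real \<times> real \<Rightarrow> real) \<in> borel_measurable borel"
    by (intro borel_measurable_continuous_onI continuous_intros)+
  have "(\<lambda>(x, y). V x y) \<in> borel_measurable borel"
    unfolding V_def case_prod_unfold by measurable
  then have V: "borel_kernel V" using p by (auto simp: borel_kernel_def V_def)
  note V2 = borel_kernel_bounded2[OF V]
  note tri = tri_density_eq[OF V, of V] and ent = graphon_entropy_eq[OF V, of V, OF _ p]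
  have e_m: "e \<in> borel_measurable unit_lborel"
    unfolding e_def using initial_ind_measurable[of s] by simp
  have int_c: "integrable unit_lborel ?c"
    using initial_ind_measurable initial_ind_bounds(3) by (rule unit_lborel.integrable_bounded)
  have int_e: "(\<integral>x. e x \<partial>unit_lborel) = 1 - s"
    unfolding e_def using int_c
    by (simp add: integral_initial_ind s prob_unit_interval)
  have e1: "\<bar>e x\<bar> \<le> 1" for x by (simp add: e_def initial_ind_def)
  have e2: "unit_lborel.bounded2 (\<lambda>x y. e x)" "unit_lborel.bounded2 (\<lambda>x y. e y)"
    by (rule unit_lborel.bounded2_fst[OF e_m e1] unit_lborel.bounded2_snd[OF e_m e1])+
  note bs = unit_lborel.bounded3_mult unit_lborel.bounded3_add unit_lborel.bounded3_const
    unit_lborel.bounded3_12[OF V2] unit_lborel.bounded3_13[OF V2] unit_lborel.bounded3_23[OF V2]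
    initial_ind_bounded3 unit_lborel.bounded3_12[OF e2(1)] unit_lborel.bounded3_12[OF e2(2)]
    unit_lborel.bounded3_13[OF e2(2)]
  let ?h = "\<lambda>x y z. p ^ 3 + ((p - p ^ 3) * (?c x * e y * e z) +
    ((p - p ^ 3) * (e x * ?c y * e z) + (p - p ^ 3) * (e x * e y * ?c z)))"
  have "(1 + \<delta>) * p ^ 3 \<le> p ^ 3 + (p - p ^ 3) * (3 * (s * (1 - s)\<^sup>2))"
    using large by (simp add: algebra_simps)
  also have "\<dots> = unit_lborel.triple_integral ?h"
    apply (subst unit_lborel.triple_integral_add, (intro bs)+)+
    by (simp add: integral_initial_ind int_e s prob_unit_interval power2_eq_square)
  also have "\<dots> \<le> unit_lborel.triple_integral (\<lambda>x y z. V x y * V x z * V y z)"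
  proof (intro unit_lborel.triple_integral_mono bs)
    fix x y z
    show "?h x y z \<le> V x y * V x z * V y z"
      using cube_bounds[OF p] by (simp add: V_def e_def initial_ind_def)
  qed
  finally have tri': "(1 + \<delta>) * p ^ 3 \<le> tri_density V" by (simp add: tri)
  have "graphon_entropy p V = unit_lborel.double_integral (\<lambda>x y. I_ent p (V x y))"
    by (simp add: ent)
  also have "\<dots> \<le> unit_lborel.double_integral (\<lambda>x y. ln (1 / p) * ?c x + ln (1 / p) * ?c y)"
  proof (intro unit_lborel.double_integral_mono borel_kernel_bounded2_I_ent V p
      unit_lborel.bounded2_add unit_lborel.bounded2_mult unit_lborel.bounded2_const initial_ind_bounded2)
    show "I_ent p (V x y) \<le> ln (1 / p) * ?c x + ln (1 / p) * ?c y" for x y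
      using p by (simp add: V_def initial_ind_def I_ent_self I_ent_one)
  qed
  also have "\<dots> = 2 * s * ln (1 / p)"
    by (subst unit_lborel.double_integral_add,
        (intro unit_lborel.bounded2_mult unit_lborel.bounded2_const initial_ind_bounded2)+)
      (simp add: integral_initial_ind s prob_unit_interval)
  finally show ?thesis using phi_le[OF borel_kernel_graphon[OF V] tri' p] by simp
qed

text \<open>The margin \<open>\<eta>\<close> absorbs the lower-order losses in the conditions of the
  two constructions once \<open>p\<close> is small.\<close>

lemma phi_upper:
  assumes "\<delta> > 0" "\<eta> > 0"
  shows "\<forall>\<^sub>F p in at_right 0. phi p \<delta> / (p\<^sup>2 * ln (1 / p)) \<le> (\<delta> + \<eta>) powr (2/3) / 2"
    and "\<forall>\<^sub>F p in at_right 0. phi p \<delta> / (p\<^sup>2 * ln (1 / p)) \<le> (\<delta> + \<eta>) / 3"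
proof -
  \<comment> \<open>A clique of side \<open>c * p\<close> has triangle density
    \<open>(\<delta> + \<eta>) * p^3\<close>.\<close>
  define c where "c = (\<delta> + \<eta>) powr (1/3)"
  have c: "0 < c" "c ^ 3 = \<delta> + \<eta>" "c\<^sup>2 = (\<delta> + \<eta>) powr (2/3)"
    using assms by (simp_all add: c_def powr_power)
  have p01: "\<forall>\<^sub>F p :: real in at_right 0. 0 < p \<and> p < 1"
    using eventually_at_right_real[of 0 1] by (simp add: greaterThanLessThan_iff)
  have lim: "((\<lambda>p :: real. (1 - p ^ 3) * (\<delta> + \<eta>)) \<longlongrightarrow> (1 - 0 ^ 3) * (\<delta> + \<eta>)) (at_right 0)"
    by (intro tendsto_intros)
  have "\<forall>\<^sub>F p in at_right 0. \<delta> < (1 - p ^ 3) * (\<delta> + \<eta>)"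
    using lim by (rule order_tendstoD) (use assms in simp)
  moreover have "((\<lambda>p. c * p) \<longlongrightarrow> c * 0) (at_right 0)" by (intro tendsto_intros)
  then have "\<forall>\<^sub>F p in at_right 0. c * p < 1" by (rule order_tendstoD) simp
  ultimately show "\<forall>\<^sub>F p in at_right 0. phi p \<delta> / (p\<^sup>2 * ln (1 / p)) \<le> (\<delta> + \<eta>) powr (2/3) / 2"
    using p01
  proof eventually_elim
    case (elim p)
    have "\<delta> * p ^ 3 \<le> (1 - p ^ 3) * (\<delta> + \<eta>) * p ^ 3"
      using elim by (intro mult_right_mono) auto
    also have "\<dots> = (1 - p ^ 3) * (c * p) ^ 3" by (simp add: power_mult_distrib c(2))
    finally have "phi p \<delta> \<le> (c * p)\<^sup>2 / 2 * ln (1 / p)"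
      using elim c(1) by (intro phi_le_clique) auto
    also have "\<dots> = (\<delta> + \<eta>) powr (2/3) / 2 * (p\<^sup>2 * ln (1 / p))"
      by (simp add: power_mult_distrib c(3))
    finally show ?case using elim by (simp add: divide_le_eq)
  qed
  \<comment> \<open>A hub of measure \<open>\<theta> * p^2\<close> adds
    \<open>3 * \<theta> * p^3\<close> triangles to leading order.\<close>
  define \<theta> where "\<theta> = (\<delta> + \<eta>) / 3"
  have \<theta>: "0 < \<theta>" "3 * \<theta> = \<delta> + \<eta>" using assms by (auto simp: \<theta>_def)
  have lim: "((\<lambda>p :: real. (1 - p\<^sup>2) * (3 * \<theta>) * (1 - \<theta> * p\<^sup>2)\<^sup>2) \<longlongrightarrow>
      (1 - 0\<^sup>2) * (3 * \<theta>) * (1 - \<theta> * 0\<^sup>2)\<^sup>2) (at_right 0)"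
    by (intro tendsto_intros)
  have "\<forall>\<^sub>F p in at_right 0. \<delta> < (1 - p\<^sup>2) * (3 * \<theta>) * (1 - \<theta> * p\<^sup>2)\<^sup>2"
    using lim by (rule order_tendstoD) (use assms \<theta> in simp)
  moreover have "((\<lambda>p. \<theta> * p\<^sup>2) \<longlongrightarrow> \<theta> * 0\<^sup>2) (at_right 0)" by (intro tendsto_intros)
  then have "\<forall>\<^sub>F p in at_right 0. \<theta> * p\<^sup>2 < 1" by (rule order_tendstoD) simp
  ultimately show "\<forall>\<^sub>F p in at_right 0. phi p \<delta> / (p\<^sup>2 * ln (1 / p)) \<le> (\<delta> + \<eta>) / 3"
    using p01
  proof eventually_elim
    case (elim p)
    have "\<delta> * p ^ 3 \<le> (1 - p\<^sup>2) * (3 * \<theta>) * (1 - \<theta> * p\<^sup>2)\<^sup>2 * p ^ 3"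
      using elim by (intro mult_right_mono) auto
    also have "\<dots> = (p - p ^ 3) * (3 * (\<theta> * p\<^sup>2 * (1 - \<theta> * p\<^sup>2)\<^sup>2))"
      by (simp add: algebra_simps power2_eq_square power3_eq_cube)
    finally have "phi p \<delta> \<le> \<theta> * p\<^sup>2 * ln (1 / p)"
      using elim \<theta>(1) by (intro phi_le_hub) auto
    then show ?case using elim by (simp add: divide_le_eq \<theta>_def mult.assoc)
  qed
qed

section \<open>The limit from matching lower and upper bounds\<close>

theorem theorem2p2:
  fixes \<delta> :: real
  assumes "\<delta> > 0"
  shows "((\<lambda>p. phi p \<delta> / (p\<^sup>2 * ln (1 / p))) \<longlongrightarrow> min (\<delta> powr (2/3) / 2) (\<delta> / 3)) (at_right 0)"
proof (rule order_tendstoI)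
  let ?m = "min (\<delta> powr (2/3) / 2) (\<delta> / 3)"
  \<comment> \<open>With this cutoff the entry \<open>C / 2\<close> in
    \<open>graphon_entropy_ge\<close> equals the claimed limit and costs nothing.\<close>
  define C where "C = 2 * ?m"
  have C: "0 < C" using assms by (simp add: C_def)
  have p01: "\<forall>\<^sub>F p :: real in at_right 0. 0 < p \<and> p < 1"
    using eventually_at_right_real[of 0 1] by (simp add: greaterThanLessThan_iff)
  {
    fix a assume a: "a < ?m"
    have lim: "((\<lambda>p. min (C / 2) (entropy_lower_bound C \<delta> p)) \<longlongrightarrow> min (C / 2) ?m) (at_right 0)"
      by (intro tendsto_min tendsto_const entropy_lower_bound_tendsto C assms)
    have "\<forall>\<^sub>F p in at_right 0. a < min (C / 2) (entropy_lower_bound C \<delta> p)"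
      using lim by (rule order_tendstoD) (use a in \<open>simp add: C_def\<close>)
    moreover have "\<forall>\<^sub>F p in at_right 0. 0 < effective_excess C \<delta> p"
      using effective_excess_tendsto[OF C] by (rule order_tendstoD) (use assms in simp)
    moreover have "((\<lambda>p :: real. (1 + \<delta>) * p ^ 3) \<longlongrightarrow> (1 + \<delta>) * 0 ^ 3) (at_right 0)"
      by (intro tendsto_intros)
    then have "\<forall>\<^sub>F p in at_right 0. (1 + \<delta>) * p ^ 3 < 1"
      by (rule order_tendstoD) simp
    ultimately show "\<forall>\<^sub>F p in at_right 0. a < phi p \<delta> / (p\<^sup>2 * ln (1 / p))"
      using p01
    proof eventually_elim
      case (elim p)
      then have p: "0 < p" "p < 1" by auto
      \<comment> \<open>The constant graphon 1 is admissible for small \<open>p\<close>, so the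
        infimum is over a nonempty set and can be bounded below.\<close>
      have one: "borel_kernel (\<lambda>x y. 1)" by (simp add: borel_kernel_def)
      have "tri_density (\<lambda>x y. 1) = 1"
        using tri_density_eq[OF one, of "\<lambda>x y. 1"] by (simp add: prob_unit_interval)
      then have "graphon (\<lambda>x y. 1) \<and> (1 + \<delta>) * p ^ 3 \<le> tri_density (\<lambda>x y. 1)"
        using borel_kernel_graphon[OF one] elim by simp
      then have "{graphon_entropy p W / 2 |W. graphon W \<and> (1 + \<delta>) * p ^ 3 \<le> tri_density W} \<noteq> {}"
        by blast
      then have "min (C / 2) (entropy_lower_bound C \<delta> p) * (p\<^sup>2 * ln (1 / p)) \<le> phi p \<delta>"
        unfolding phi_def
        by (rule cInf_greatest) (use graphon_entropy_ge[OF _ _ p elim(2)] in blast)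
      then have "min (C / 2) (entropy_lower_bound C \<delta> p) \<le> phi p \<delta> / (p\<^sup>2 * ln (1 / p))"
        using p by (simp add: le_divide_eq)
      with elim(1) show ?case by linarith
    qed
  }
  {
    fix a assume a: "?m < a"
    \<comment> \<open>By continuity some fixed positive \<open>\<eta>\<close> keeps the minimum
      below \<open>a\<close>; whichever of the clique and hub values is smaller then gives the
      bound.\<close>
    have "((\<lambda>\<eta>. min ((\<delta> + \<eta>) powr (2/3) / 2) ((\<delta> + \<eta>) / 3)) \<longlongrightarrow>
        min ((\<delta> + 0) powr (2/3) / 2) ((\<delta> + 0) / 3)) (at_right 0)"
      using assms by (intro tendsto_intros) auto
    then have "\<forall>\<^sub>F \<eta> in at_right 0. min ((\<delta> + \<eta>) powr (2/3) / 2) ((\<delta> + \<eta>) / 3) < a"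
      by (rule order_tendstoD) (use a in simp)
    with eventually_at_right_less[of "0::real"]
    have "\<forall>\<^sub>F \<eta> in at_right 0. 0 < \<eta> \<and> min ((\<delta> + \<eta>) powr (2/3) / 2) ((\<delta> + \<eta>) / 3) < a"
      by eventually_elim auto
    then obtain \<eta> where \<eta>: "0 < \<eta>" "min ((\<delta> + \<eta>) powr (2/3) / 2) ((\<delta> + \<eta>) / 3) < a"
      using eventually_happens'[OF trivial_limit_at_right_real] by blast
    show "\<forall>\<^sub>F p in at_right 0. phi p \<delta> / (p\<^sup>2 * ln (1 / p)) < a"
      using phi_upper[OF assms \<eta>(1)] by eventually_elim (use \<eta>(2) in linarith)
  }
qed

end
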